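(* Let $\varepsilon\ge 0$ and let $x=(x_1,x_2)\in\Omega_\varepsilon$. (i) If $0\le\varepsilon<1$, then $\mathbf{B}^+_{\varepsilon}(x)=B^+_{\varepsilon}(x)$. (ii) If $\varepsilon\ge 1$, then $\mathbf{B}^+_{\varepsilon}(x)=e^{x_1}$ if $x_2=x_1^2$, and $\mathbf{B}^+_{\varepsilon}(x)=+\infty$ if $x_2>x_1^2$. (iii) For all $\varepsilon\ge0$, $\mathbf{B}^-_{\varepsilon}(x)=B^-_{\varepsilon}(x)$.
   Context: For a bounded interval $J$, $\langle\varphi\rangle_J=\frac1{|J|}\int_J\varphi$. $\mathrm{BMO}(I)$ is the set of real-valued $\varphi\in L^1(I)$ with $\|\varphi\|_{\mathrm{BMO}(I)}=\bigl(\sup_{J\subset I}\{\langle\varphi^2\rangle_J-\langle\varphi\rangle_J^2\}\bigr)^{1/2}<\infty$ (supremum over all subintervals $J\subset I$), and $\mathrm{BMO}_\varepsilon(I)=\{\varphi\in\mathrm{BMO}(I):\|\varphi\|_{\mathrm{BMO}(I)}\le\varepsilon\}$. For $\varepsilon\ge0$ let $$\Omega_\varepsilon=\{x=(x_1,x_2): x_1\in\mathbb{R},\ x_1^2\le x_2\le x_1^2+\varepsilon^2\}.$$ For a bounded interval $I$ and $x\in\Omega_\varepsilon$ define the Bellman functions (which do not depend on $I$; values in $[0,+\infty]$) $$\mathbf{B}^+_{\varepsilon}(x)=\sup_{\varphi\in \mathrm{BMO}_{\varepsilon}(I)}\{\langle e^\varphi\rangle_I:\ \langle\varphi\rangle_I=x_1,\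 \langle\varphi^2\rangle_I=x_2\},$$ $$\mathbf{B}^-_{\varepsilon}(x)=\inf_{\varphi\in \mathrm{BMO}_{\varepsilon}(I)}\{\langle e^\varphi\rangle_I:\ \langle\varphi\rangle_I=x_1,\ \langle\varphi^2\rangle_I=x_2\}.$$ The explicit functions are, for $x\in\Omega_\delta$ (with $0\le\delta<1$ for $B^+_\delta$ and $\delta\ge0$ for $B^-_\delta$), $$B^+_{\delta}(x)=\frac{1-\sqrt{\delta^2+x_1^2-x_2}}{1-\delta}\exp\Bigl(x_1+\sqrt{\delta^2+x_1^2-x_2}-\delta\Bigr),$$ $$B^-_{\delta}(x)=\frac{1+\sqrt{\delta^2+x_1^2-x_2}}{1+\delta}\exp\Bigl(x_1-\sqrt{\delta^2+x_1^2-x_2}+\delta\Bigr).$$ *)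

theory Defs
  imports "HOL-Analysis.Analysis"
begin

text \<open>Intervals may or may not contain their endpoints; they have positive length, so that
  averages over them make sense.\<close>

definition bdd_interval :: "real set \<Rightarrow> bool" where
  "bdd_interval J \<longleftrightarrow> is_interval J \<and> bounded J \<and> interior J \<noteq> {}"

definition avg :: "real set \<Rightarrow> (real \<Rightarrow> real) \<Rightarrow> real" where
  "avg J f = (LINT t:J|lebesgue. f t) / measure lebesgue J"

text \<open>Average of a nonnegative function, with value \<open>\<infinity>\<close> if the function is not integrable
  (the Bochner integral in \<open>avg\<close> would then be \<open>0\<close>).\<close>

definition nn_avg :: "real set \<Rightarrow> (real \<Rightarrow> real) \<Rightarrow> ennreal" where
  "nn_avg J f = (\<integral>\<^sup>+t\<in>J. ennreal (f t) \<partial>lebesgue) / emeasure lebesgue J"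

definition bmo_sup :: "real set \<Rightarrow> (real \<Rightarrow> real) \<Rightarrow> ereal" where
  "bmo_sup I \<phi> = (SUP J\<in>{J. bdd_interval J \<and> J \<subseteq> I}.
     enn2ereal (nn_avg J (\<lambda>t. (\<phi> t)\<^sup>2)) - ereal ((avg J \<phi>)\<^sup>2))"

definition BMO :: "real set \<Rightarrow> (real \<Rightarrow> real) set" where
  "BMO I = {\<phi>. set_integrable lebesgue I \<phi> \<and> bmo_sup I \<phi> < \<infinity>}"

text \<open>Only meaningful on \<open>BMO I\<close>, where \<open>bmo_sup I \<phi>\<close> is finite.\<close>

definition bmo_norm :: "real set \<Rightarrow> (real \<Rightarrow> real) \<Rightarrow> real" where
  "bmo_norm I \<phi> = sqrt (real_of_ereal (bmo_sup I \<phi>))"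

definition BMO_ball :: "real \<Rightarrow> real set \<Rightarrow> (real \<Rightarrow> real) set" where
  "BMO_ball \<epsilon> I = {\<phi> \<in> BMO I. bmo_norm I \<phi> \<le> \<epsilon>}"

definition Omega :: "real \<Rightarrow> (real \<times> real) set" where
  "Omega \<epsilon> = {(x1, x2). x1\<^sup>2 \<le> x2 \<and> x2 \<le> x1\<^sup>2 + \<epsilon>\<^sup>2}"

text \<open>For \<open>\<phi>\<close> in \<open>BMO I\<close> the square of \<open>\<phi>\<close> is integrable on \<open>I\<close>, so the real-valued
  average is used for the second moment; the average of \<open>exp \<circ> \<phi>\<close> may be infinite.\<close>

definition test_functions :: "real set \<Rightarrow> real \<Rightarrow> real \<times> real \<Rightarrow> (real \<Rightarrow> real) set" where
  "test_functions I \<epsilon> = (\<lambda>(x1, x2).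
     {\<phi> \<in> BMO_ball \<epsilon> I. avg I \<phi> = x1 \<and> avg I (\<lambda>t. (\<phi> t)\<^sup>2) = x2})"

definition Bellman_sup :: "real set \<Rightarrow> real \<Rightarrow> real \<times> real \<Rightarrow> ennreal" where
  "Bellman_sup I \<epsilon> x = (SUP \<phi>\<in>test_functions I \<epsilon> x. nn_avg I (\<lambda>t. exp (\<phi> t)))"

definition Bellman_inf :: "real set \<Rightarrow> real \<Rightarrow> real \<times> real \<Rightarrow> ennreal" where
  "Bellman_inf I \<epsilon> x = (INF \<phi>\<in>test_functions I \<epsilon> x. nn_avg I (\<lambda>t. exp (\<phi> t)))"

definition B_plus :: "real \<Rightarrow> real \<times> real \<Rightarrow> real" where
  "B_plus \<delta> = (\<lambda>(x1, x2). (1 - sqrt (\<delta>\<^sup>2 + x1\<^sup>2 - x2)) / (1 - \<delta>)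
     * exp (x1 + sqrt (\<delta>\<^sup>2 + x1\<^sup>2 - x2) - \<delta>))"

definition B_minus :: "real \<Rightarrow> real \<times> real \<Rightarrow> real" where
  "B_minus \<delta> = (\<lambda>(x1, x2). (1 + sqrt (\<delta>\<^sup>2 + x1\<^sup>2 - x2)) / (1 + \<delta>)
     * exp (x1 - sqrt (\<delta>\<^sup>2 + x1\<^sup>2 - x2) + \<delta>))"

end

theory Submission
  imports Defs "HOL-Real_Asymp.Real_Asymp"
begin

text \<open>For \<open>\<delta> > \<epsilon>\<close> every \<open>\<phi>\<close> in the ball of radius \<open>\<epsilon>\<close> admits a splitting of its interval, in a ratio bounded
  away from \<open>0\<close> and \<open>1\<close>, such that the segment joining the two points of averages of \<open>(\<phi>, \<phi>\<^sup>2)\<close> stays in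
  \<open>Omega \<delta>\<close>. The candidates with parameter \<open>\<delta>\<close> are concave resp. convex on such segments, so
  iterating the splitting compares \<open>\<langle>exp \<phi>\<rangle>\<close> with the candidate, up to an error on the small leaves.
  For bounded \<open>\<phi>\<close> this error vanishes, because \<open>\<phi>\<close> is approximated in \<open>L\<^sup>1\<close> by a continuous function.
  Truncation, which does not increase variances, and \<open>\<delta> \<rightarrow> \<epsilon>\<close> give the general bounds. They are
  attained by cut-off logarithms \<open>c \<plusminus> \<epsilon> * max 0 (ln (A / (t - a)))\<close>, whose exponential is not integrable
  when the sign is \<open>+\<close>, \<open>\<epsilon> \<ge> 1\<close> and \<open>A > 0\<close>.\<close>

section \<open>Concavity of the candidates and the tangent argument\<close>

text \<open>\<open>Omega \<epsilon>\<close> is not convex: an interval and both its parts may have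
  their points in it while the segment between the parts crosses the upper parabola, and the
  candidates are concave or convex only along segments inside their own domain. The strip between
  the upper parabolas of radius \<epsilon> and \<delta> is the room in which a good cut is found.
  For \<delta> = \<epsilon> the guaranteed ratio
  \<open>sqrt (\<delta>\<^sup>2 - \<epsilon>\<^sup>2) / \<delta>\<close> is 0, which is why
  \<epsilon> is reached only by a limit. The formulas come from tangents. On a tangent to the upper
  parabola, between the point of contact and the end on \<open>x2 = x1\<^sup>2\<close> on the side
  selected by \<sigma>, the exponent
  \<open>x1 + \<sigma> * sqrt (\<delta>\<^sup>2 + x1\<^sup>2 - x2)\<close> is constant, so
  \<open>Bell\<close> is affine there, with value \<open>exp x1\<close> at the lower end. The
  logarithms follow these lines: \<open>ln\<close> has variance 1 on every initial interval, so
  averages over \<open>{a..a + s}\<close> lie on the upper parabola of radius \<epsilon> until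
  \<open>s\<close> reaches \<open>A\<close>, and then descend along the tangent towards the constant
  \<open>c\<close>. The threshold 1 is the integrability of the power \<open>- \<epsilon>\<close> of
  \<open>t - a\<close>.\<close>

text \<open>The two candidates are one formula: \<open>\<sigma> = 1\<close> gives \<open>B_plus\<close> and \<open>\<sigma> = -1\<close> gives
  \<open>B_minus\<close>. Upper bounds for \<open>\<sigma> * \<langle>exp \<phi>\<rangle>\<close> then cover both Bellman functions.\<close>

definition Bell :: "real \<Rightarrow> real \<Rightarrow> real \<Rightarrow> real \<Rightarrow> real" where
  "Bell \<sigma> \<delta> x1 x2 = (1 - \<sigma> * sqrt (\<delta>\<^sup>2 + x1\<^sup>2 - x2)) / (1 - \<sigma> * \<delta>)
     * exp (x1 + \<sigma> * sqrt (\<delta>\<^sup>2 + x1\<^sup>2 - x2) - \<sigma> * \<delta>)"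

text \<open>Along a line, \<open>\<delta>\<^sup>2 + x1\<^sup>2 - x2\<close> is a quadratic \<open>w\<close> with leading coefficient \<open>p\<^sup>2\<close>, where \<open>p\<close> is the
  slope of \<open>x1\<close>. With \<open>r = \<sigma> * sqrt w\<close> the second derivative of \<open>(1 - r) * exp (x1 + r)\<close> collapses to
  \<open>- r * (p + r')\<^sup>2 * exp (x1 + r)\<close>, because \<open>(r * r)'' = 2 * p\<^sup>2\<close>.\<close>

lemma Bell_profile_concave_pos:
  fixes p q b c \<sigma> :: real
  assumes \<sigma>: "\<sigma>\<^sup>2 = 1"
    and w: "\<And>t. t \<in> {0..1} \<Longrightarrow> p\<^sup>2 * t\<^sup>2 + b * t + c > 0"
  shows "concave_on {0..1} (\<lambda>t. \<sigma> * ((1 - \<sigma> * sqrt (p\<^sup>2 * t\<^sup>2 + b * t + c)) *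
            exp (q + p * t + \<sigma> * sqrt (p\<^sup>2 * t\<^sup>2 + b * t + c))))"
proof -
  define w where "w t = p\<^sup>2 * t\<^sup>2 + b * t + c" for t
  define w' where "w' t = 2 * p\<^sup>2 * t + b" for t
  define E where "E t = exp (q + p * t + \<sigma> * sqrt (w t))" for t
  define F' where "F' t = \<sigma> * ((p * (1 - \<sigma> * sqrt (w t)) - w' t / 2) * E t)" for t
  define F'' where "F'' t = - (sqrt (w t) * (p + \<sigma> * (w' t / (2 * sqrt (w t))))\<^sup>2 * E t)" for t
  have dw: "(w has_real_derivative w' t) (at t)" for t
    unfolding w_def w'_def by (auto intro!: derivative_eq_intros)
  have dw': "(w' has_real_derivative 2 * p\<^sup>2) (at t)" for t
    unfolding w'_def by (auto intro!: derivative_eq_intros)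
  have ds: "((\<lambda>t. sqrt (w t)) has_real_derivative (w' t / (2 * sqrt (w t)))) (at t)" if "w t > 0" for t
  proof -
    have "((\<lambda>t. sqrt (w t)) has_real_derivative (inverse (sqrt (w t)) / 2 * w' t)) (at t)"
      using DERIV_chain2[OF DERIV_real_sqrt[OF that] dw] .
    then show ?thesis by (simp add: field_simps)
  qed
  have dE: "(E has_real_derivative (p + \<sigma> * (w' t / (2 * sqrt (w t)))) * E t) (at t)" if "w t > 0" for t
  proof -
    have "((\<lambda>t. q + p * t + \<sigma> * sqrt (w t)) has_real_derivative p + \<sigma> * (w' t / (2 * sqrt (w t)))) (at t)"
      by (rule ds that derivative_eq_intros refl | simp)+
    from DERIV_fun_exp[OF this] show ?thesis by (simp add: E_def[abs_def] mult.commute)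
  qed
  have s3: "\<sigma> * (\<sigma> * x) = x" for x
    using \<sigma> by (simp add: power2_eq_square flip: mult.assoc)
  have pos: "w t > 0" if "t \<in> {0..1}" for t
    using w[OF that] by (simp add: w_def)
  have "concave_on {0..1} (\<lambda>t. \<sigma> * ((1 - \<sigma> * sqrt (w t)) * E t))"
  proof (rule f''_le0_imp_concave[where f' = F' and f'' = F''])
    fix t :: real assume t: "t \<in> {0..1}"
    define s where "s = sqrt (w t)"
    have s: "s > 0" "w t = s\<^sup>2" using pos[OF t] by (auto simp: s_def)
    have 1: "((\<lambda>t. \<sigma> * ((1 - \<sigma> * sqrt (w t)) * E t)) has_real_derivative
       \<sigma> * ((- (\<sigma> * (w' t / (2 * s)))) * E t + (1 - \<sigma> * s) * ((p + \<sigma> * (w' t / (2 * s))) * E t))) (at t)"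
      unfolding s_def by (rule ds dE pos t derivative_eq_intros refl | simp)+
    \<comment> \<open>With \<open>r = \<sigma> * s\<close> the bracket
      \<open>- r' + (1 - r) * (p + r')\<close> equals \<open>p * (1 - r) - r * r'\<close>, and
      \<open>r * r' = w' / 2\<close>, so no root remains in a denominator of
      \<open>F'\<close>.\<close>
    have "- (\<sigma> * (w' t / (2 * s))) + (1 - \<sigma> * s) * (p + \<sigma> * (w' t / (2 * s))) = p * (1 - \<sigma> * s) - w' t / 2"
      using s(1) \<sigma> by (simp add: field_simps power2_eq_square s3)
    then have "(- (\<sigma> * (w' t / (2 * s)))) * E t + (1 - \<sigma> * s) * ((p + \<sigma> * (w' t / (2 * s))) * E t)
       = (p * (1 - \<sigma> * s) - w' t / 2) * E t"
      by (metis (no_types, lifting) distrib_right mult.assoc)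
    with 1 show "((\<lambda>t. \<sigma> * ((1 - \<sigma> * sqrt (w t)) * E t)) has_real_derivative F' t) (at t)"
      by (simp add: F'_def s_def)
    have 2: "(F' has_real_derivative \<sigma> * ((- (p * (\<sigma> * (w' t / (2 * s)))) - p\<^sup>2) * E t
        + (p * (1 - \<sigma> * s) - w' t / 2) * ((p + \<sigma> * (w' t / (2 * s))) * E t))) (at t)"
      unfolding F'_def[abs_def] s_def
      by (rule ds dE dw' pos t derivative_eq_intros refl | simp)+
    define r where "r = w' t / (2 * s)"
    have w't: "w' t = 2 * s * r" using s by (simp add: r_def)
    have "\<sigma> * ((- (p * (\<sigma> * r)) - p\<^sup>2) + (p * (1 - \<sigma> * s) - w' t / 2) * (p + \<sigma> * r)) = - (s * (p + \<sigma> * r)\<^sup>2)"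
      unfolding w't by (simp add: algebra_simps power2_eq_square s3)
    then have "\<sigma> * ((- (p * (\<sigma> * r)) - p\<^sup>2) * E t + (p * (1 - \<sigma> * s) - w' t / 2) * ((p + \<sigma> * r) * E t))
        = - (s * (p + \<sigma> * r)\<^sup>2) * E t"
      by (metis (no_types, lifting) distrib_right mult.assoc)
    with 2 show "(F' has_real_derivative F'' t) (at t)"
      by (simp add: F''_def s_def[symmetric] r_def)
    show "F'' t \<le> 0" using pos[OF t] by (simp add: F''_def E_def)
  qed auto
  then show ?thesis by (simp add: w_def E_def)
qed

text \<open>Where a segment touches the upper parabola the radicand vanishes and the root is not
  differentiable. Raising the radicand by \<eta> > 0 restores the strict case, and both sides depend
  continuously on \<eta>.\<close>

lemma Bell_profile_concave:
  fixes p q b c \<sigma> t :: real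
  assumes \<sigma>: "\<sigma>\<^sup>2 = 1"
    and w: "\<And>t. t \<in> {0..1} \<Longrightarrow> p\<^sup>2 * t\<^sup>2 + b * t + c \<ge> 0"
    and t: "t \<in> {0..1}"
  defines "F \<equiv> (\<lambda>\<eta> t. \<sigma> * ((1 - \<sigma> * sqrt (p\<^sup>2 * t\<^sup>2 + b * t + (c + \<eta>))) *
            exp (q + p * t + \<sigma> * sqrt (p\<^sup>2 * t\<^sup>2 + b * t + (c + \<eta>)))))"
  shows "(1 - t) * F 0 0 + t * F 0 1 \<le> F 0 t"
proof (rule tendsto_le)
  have lim: "((\<lambda>\<eta>. F \<eta> s) \<longlongrightarrow> F 0 s) (at_right 0)" for s
    unfolding F_def by (intro tendsto_intros)
  show "((\<lambda>\<eta>. F \<eta> t) \<longlongrightarrow> F 0 t) (at_right 0)" by (rule lim)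
  show "((\<lambda>\<eta>. (1 - t) * F \<eta> 0 + t * F \<eta> 1) \<longlongrightarrow> (1 - t) * F 0 0 + t * F 0 1) (at_right 0)"
    by (intro tendsto_intros lim)
  have "(1 - t) * F \<eta> 0 + t * F \<eta> 1 \<le> F \<eta> t" if "\<eta> > 0" for \<eta>
  proof -
    have "concave_on {0..1} (F \<eta>)"
      unfolding F_def
    proof (rule Bell_profile_concave_pos[OF \<sigma>])
      fix s :: real assume "s \<in> {0..1}"
      from w[OF this] that show "p\<^sup>2 * s\<^sup>2 + b * s + (c + \<eta>) > 0" by linarith
    qed
    then have "convex_on {0..1} (\<lambda>s. - F \<eta> s)" by (simp add: concave_on_def)
    from convex_onD[OF this, of t 0 1] t show ?thesis by (simp add: algebra_simps)
  qed
  then show "\<forall>\<^sub>F \<eta> in at_right 0. (1 - t) * F \<eta> 0 + t * F \<eta> 1 \<le> F \<eta> t"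
    by (intro eventually_mono[OF eventually_at_right_less])
qed simp

text \<open>On a segment the radicand is a quadratic with leading coefficient
  \<open>(z1 - y1)\<^sup>2\<close>, the form that the profile requires; \<open>seg\<close> is its
  nonnegativity.\<close>

lemma Bell_concave_segment:
  fixes \<sigma> \<delta> t :: real
  assumes \<sigma>: "\<sigma>\<^sup>2 = 1" and \<sigma>\<delta>: "\<sigma> * \<delta> < 1"
    and seg: "\<And>\<theta>. \<theta> \<in> {0..1} \<Longrightarrow> (1-\<theta>) * y2 + \<theta> * z2 \<le> ((1-\<theta>) * y1 + \<theta> * z1)\<^sup>2 + \<delta>\<^sup>2"
    and t: "t \<in> {0..1}"
  shows "(1 - t) * (\<sigma> * Bell \<sigma> \<delta> y1 y2) + t * (\<sigma> * Bell \<sigma> \<delta> z1 z2)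
     \<le> \<sigma> * Bell \<sigma> \<delta> ((1-t) * y1 + t * z1) ((1-t) * y2 + t * z2)"
proof -
  define p where "p = z1 - y1"
  define b where "b = 2 * y1 * p - (z2 - y2)"
  define c where "c = \<delta>\<^sup>2 + y1\<^sup>2 - y2"
  have w: "p\<^sup>2 * s\<^sup>2 + b * s + (c + 0) = \<delta>\<^sup>2 + ((1-s) * y1 + s * z1)\<^sup>2 - ((1-s) * y2 + s * z2)" for s
    by (simp add: p_def b_def c_def power2_eq_square algebra_simps)
  define K where "K s = (1 - \<sigma> * sqrt (p\<^sup>2 * s\<^sup>2 + b * s + (c + 0))) *
            exp ((y1 - \<sigma> * \<delta>) + p * s + \<sigma> * sqrt (p\<^sup>2 * s\<^sup>2 + b * s + (c + 0)))" for s
  have K: "Bell \<sigma> \<delta> ((1-s) * y1 + s * z1) ((1-s) * y2 + s * z2) = K s / (1 - \<sigma> * \<delta>)" for s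
    unfolding Bell_def K_def w by (simp add: p_def algebra_simps)
  have "(1 - t) * (\<sigma> * K 0) + t * (\<sigma> * K 1) \<le> \<sigma> * K t"
    unfolding K_def
  proof (rule Bell_profile_concave[OF \<sigma> _ t])
    fix s :: real assume "s \<in> {0..1}"
    from seg[OF this] w[of s] show "p\<^sup>2 * s\<^sup>2 + b * s + c \<ge> 0" by simp
  qed
  then have "((1 - t) * (\<sigma> * K 0) + t * (\<sigma> * K 1)) / (1 - \<sigma> * \<delta>) \<le> \<sigma> * K t / (1 - \<sigma> * \<delta>)"
    using \<sigma>\<delta> by (intro divide_right_mono) auto
  then show ?thesis using K[of 0] K[of 1] K[of t] by (simp add: add_divide_distrib)
qed

text \<open>\<open>y l\<close> and \<open>z l\<close> are the averages over the large and the small part when the small part is the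
  fraction \<open>l\<close> of the interval. As \<open>l\<close> grows from \<open>0\<close>, stop at the first \<open>l\<close> for which the segment
  from \<open>x\<close> to \<open>y l\<close> touches the upper parabola of \<open>Omega \<delta>\<close>: it is tangent there, so the whole line
  stays below the parabola. The tangent meets \<open>Omega \<epsilon>\<close> only at horizontal distance at least
  \<open>sqrt (\<delta>\<^sup>2 - \<epsilon>\<^sup>2)\<close> from the point of tangency, and the region above \<open>x2 = x1\<^sup>2\<close> only up to distance
  \<open>\<delta>\<close>, which bounds \<open>l\<close> from below.\<close>

lemma tangent_splitting:
  fixes x1 x2 \<epsilon> \<delta> :: real and y1 y2 :: "real \<Rightarrow> real"
  assumes "0 \<le> \<epsilon>" "\<epsilon> < \<delta>"
    and cont: "continuous_on {0..1/2} y1" "continuous_on {0..1/2} y2"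
    and y0: "y1 0 = x1" "y2 0 = x2"
    and y: "\<And>l. l \<in> {0..1/2} \<Longrightarrow> y2 l \<le> (y1 l)\<^sup>2 + \<epsilon>\<^sup>2"
    and bad: "\<theta>0 \<in> {0..1}" "(1-\<theta>0) * x2 + \<theta>0 * y2 (1/2) > ((1-\<theta>0) * x1 + \<theta>0 * y1 (1/2))\<^sup>2 + \<delta>\<^sup>2"
    and z: "\<And>l. l \<in> {0<..1/2} \<Longrightarrow> (z1 l)\<^sup>2 \<le> z2 l"
    and bary: "\<And>l. l \<in> {0<..1/2} \<Longrightarrow> l * z1 l + (1-l) * y1 l = x1"
              "\<And>l. l \<in> {0<..1/2} \<Longrightarrow> l * z2 l + (1-l) * y2 l = x2"
  obtains l where "l \<in> {0<..1/2}" "l \<ge> sqrt (\<delta>\<^sup>2 - \<epsilon>\<^sup>2) / \<delta>"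
    "\<And>\<theta>. (1-\<theta>) * z2 l + \<theta> * y2 l \<le> ((1-\<theta>) * z1 l + \<theta> * y1 l)\<^sup>2 + \<delta>\<^sup>2"
proof -
  define W where "W l \<theta> = \<delta>\<^sup>2 + ((1-\<theta>) * x1 + \<theta> * y1 l)\<^sup>2 - ((1-\<theta>) * x2 + \<theta> * y2 l)" for l \<theta>
  \<comment> \<open>Pairs whose point on the segment from \<open>x\<close> to \<open>y l\<close>
    lies on or above the upper parabola. By compactness the least first coordinate is attained; it
    is the stopping parameter.\<close>
  define T where "T = ({0..1/2} \<times> {0..1::real}) \<inter> (\<lambda>(l,\<theta>). W l \<theta>) -` {..0}"
  have cW: "continuous_on ({0..1/2} \<times> {0..1}) (\<lambda>(l,\<theta>). W l \<theta>)"
    unfolding W_def case_prod_unfold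
    by (intro continuous_intros continuous_on_compose2[OF cont(1)] continuous_on_compose2[OF cont(2)]) auto
  have "closed T" unfolding T_def
    by (rule continuous_closed_preimage[OF cW]) (auto intro: closed_Times)
  moreover have "bounded T"
    by (rule bounded_subset[of "{0..1/2} \<times> {0..1}"]) (auto simp: T_def intro: bounded_Times)
  ultimately have "compact T" by (simp add: compact_eq_bounded_closed)
  then have cS: "compact (fst ` T)"
    by (intro compact_continuous_image continuous_intros)
  have "(1/2, \<theta>0) \<in> T" using bad by (auto simp: T_def W_def)
  then have "fst ` T \<noteq> {}" by blast
  with compact_attains_inf[OF cS] obtain l where l: "l \<in> fst ` T" and min: "\<And>m. m \<in> fst ` T \<Longrightarrow> l \<le> m"
    by blast
  from l obtain \<theta>' where th: "l \<in> {0..1/2}" "\<theta>' \<in> {0..1}" "W l \<theta>' \<le> 0" by (auto simp: T_def)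
  have d2: "\<epsilon>\<^sup>2 < \<delta>\<^sup>2" using assms(1,2) by (intro power_strict_mono) auto
  \<comment> \<open>Both ends of the segment lie below the parabola of radius \<epsilon>, so their
    gap to the larger one is bounded below and contact can only be interior.\<close>
  have ends: "W m 0 \<ge> \<delta>\<^sup>2 - \<epsilon>\<^sup>2" "W m 1 \<ge> \<delta>\<^sup>2 - \<epsilon>\<^sup>2" if "m \<in> {0..1/2}" for m
    using y[of 0] y0 y[OF that] by (auto simp: W_def)
  have "l \<noteq> 0"
  proof
    assume "l = 0"
    then have "W l \<theta>' = W 0 0" by (simp add: W_def y0 algebra_simps)
    with th ends(1)[of 0] d2 show False by simp
  qed
  with th have l0: "l \<in> {0<..1/2}" by auto
  \<comment> \<open>By minimality of \<open>l\<close> no pair with a smaller first coordinate is in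
    \<open>T\<close>; the sign passes to the limit from the left.\<close>
  have nonneg: "W l \<theta> \<ge> 0" if "\<theta> \<in> {0..1}" for \<theta>
  proof (rule ccontr)
    assume neg: "\<not> ?thesis"
    have cm: "continuous_on {0..1/2} (\<lambda>m. W m \<theta>)"
      unfolding W_def by (intro continuous_intros cont)
    have lim: "((\<lambda>m. W m \<theta>) \<longlongrightarrow> W l \<theta>) (at l within {0..1/2})"
      using cm th(1) by (auto simp: continuous_on_def)
    have "at l within {0..<l} \<le> at l within {0..1/2}"
      using l0 by (intro at_le) auto
    from tendsto_mono[OF this lim] have lim: "((\<lambda>m. W m \<theta>) \<longlongrightarrow> W l \<theta>) (at l within {0..<l})" .
    have ntriv: "at l within {0..<l} \<noteq> bot"
      using l0 by (simp add: at_within_eq_bot_iff)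
    have "W l \<theta> \<ge> 0"
    proof (rule tendsto_lowerbound[OF lim _ ntriv])
      have "W m \<theta> \<ge> 0" if m: "m \<in> {0..<l}" for m
      proof (rule ccontr)
        assume "\<not> ?thesis"
        then have "(m, \<theta>) \<in> T" using m l0 \<open>\<theta> \<in> {0..1}\<close> by (auto simp: T_def)
        then have "m \<in> fst ` T" by force
        from min[OF this] m show False by simp
      qed
      then show "\<forall>\<^sub>F m in at l within {0..<l}. 0 \<le> W m \<theta>"
        by (auto simp: eventually_at_filter)
    qed
    with neg show False by simp
  qed
  define p where "p = y1 l - x1"
  define b where "b = 2 * x1 * p - (y2 l - x2)"
  define c where "c = \<delta>\<^sup>2 + x1\<^sup>2 - x2"
  have Wq: "W l \<theta> = p\<^sup>2 * \<theta>\<^sup>2 + b * \<theta> + c" for \<theta>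
    by (simp add: W_def p_def b_def c_def power2_eq_square algebra_simps)
  have W0: "W l \<theta>' = 0" using th nonneg by force
  have thin: "0 < \<theta>'" "\<theta>' < 1"
  proof -
    have "\<theta>' \<noteq> 0" "\<theta>' \<noteq> 1" using W0 ends[OF th(1)] d2 by auto
    with th(2) show "0 < \<theta>'" "\<theta>' < 1" by auto
  qed
  have deriv: "(W l has_real_derivative (2 * p\<^sup>2 * \<theta>' + b)) (at \<theta>')"
    unfolding Wq[abs_def] by (auto intro!: derivative_eq_intros)
  \<comment> \<open>The contact is an interior minimum with value 0 of a quadratic with leading
    coefficient \<open>p\<^sup>2\<close>, so the quadratic is a perfect square.\<close>
  have "2 * p\<^sup>2 * \<theta>' + b = 0"
  proof (rule DERIV_local_min[OF deriv])
    show "0 < min \<theta>' (1 - \<theta>')" using thin by simp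
    show "\<forall>y. \<bar>\<theta>' - y\<bar> < min \<theta>' (1 - \<theta>') \<longrightarrow> W l \<theta>' \<le> W l y"
    proof (intro allI impI)
      fix y assume "\<bar>\<theta>' - y\<bar> < min \<theta>' (1 - \<theta>')"
      then have "y \<in> {0..1}" by auto
      with nonneg W0 show "W l \<theta>' \<le> W l y" by simp
    qed
  qed
  then have b: "b = - 2 * p\<^sup>2 * \<theta>'" by simp
  with W0 have c: "c = p\<^sup>2 * \<theta>'\<^sup>2" by (simp add: Wq power2_eq_square algebra_simps)
  have Wsq: "W l \<theta> = (p * (\<theta> - \<theta>'))\<^sup>2" for \<theta>
    unfolding Wq b c by (simp add: power2_eq_square algebra_simps)
  \<comment> \<open>Since \<open>x = l * z + (1 - l) * y\<close>, the point \<open>z\<close> has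
    parameter \<open>- (1 - l) / l\<close> on the line through \<open>x\<close> and
    \<open>y l\<close>. The perfect square therefore gives the gap along the whole line.\<close>
  have line: "\<delta>\<^sup>2 + ((1-\<theta>) * z1 l + \<theta> * y1 l)\<^sup>2 - ((1-\<theta>) * z2 l + \<theta> * y2 l) = W l (\<theta> - (1-\<theta>) * ((1-l)/l))" for \<theta>
  proof -
    have z12: "z1 l = x1 - (1-l)/l * p" "z2 l = x2 - (1-l)/l * (y2 l - x2)"
      using bary[OF l0] l0 by (auto simp: p_def field_simps)
    define r where "r = (1-l)/l"
    have "(1-\<theta>) * z1 l + \<theta> * y1 l = (1 - (\<theta> - (1-\<theta>) * r)) * x1 + (\<theta> - (1-\<theta>) * r) * y1 l"
      "(1-\<theta>) * z2 l + \<theta> * y2 l = (1 - (\<theta> - (1-\<theta>) * r)) * x2 + (\<theta> - (1-\<theta>) * r) * y2 l"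
      unfolding z12 r_def[symmetric] p_def by (simp_all add: algebra_simps)
    then show ?thesis unfolding W_def r_def[symmetric] by simp
  qed
  define \<rho> where "\<rho> = sqrt (\<delta>\<^sup>2 - \<epsilon>\<^sup>2)"
  have rho: "\<rho> \<ge> 0" "\<rho>\<^sup>2 = \<delta>\<^sup>2 - \<epsilon>\<^sup>2" using d2 by (auto simp: \<rho>_def)
  \<comment> \<open>The root of the gap is the horizontal distance to the contact: at least \<rho>
    at either end, hence a segment of width at least \<open>2 * \<rho>\<close>.\<close>
  have "\<rho>\<^sup>2 \<le> (\<bar>p\<bar> * \<theta>')\<^sup>2" "\<rho>\<^sup>2 \<le> (\<bar>p\<bar> * (1 - \<theta>'))\<^sup>2"
    using ends[OF th(1)] unfolding rho Wsq by (simp_all only: power_mult_distrib power2_abs diff_0 power2_minus)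
  from power2_le_imp_le[OF this(1)] power2_le_imp_le[OF this(2)]
  have "\<rho> \<le> \<bar>p\<bar> * \<theta>'" "\<rho> \<le> \<bar>p\<bar> * (1 - \<theta>')"
    using thin by simp_all
  then have p2: "2 * \<rho> \<le> \<bar>p\<bar>" by (simp add: algebra_simps)
  \<comment> \<open>As \<open>z\<close> lies above \<open>x2 = x1\<^sup>2\<close>, its gap is at
    most \<open>\<delta>\<^sup>2\<close>, so it is within horizontal distance \<delta> of the
    contact. Together with \<open>1 - l \<ge> 1/2\<close> and
    \<open>2 * \<rho> \<le> \<bar>p\<bar>\<close> this yields
    \<open>\<rho> \<le> \<delta> * l\<close>.\<close>
  have "(\<bar>p\<bar> * ((1-l)/l + \<theta>'))\<^sup>2 \<le> \<delta>\<^sup>2"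
  proof -
    have "W l (- ((1-l)/l)) = (\<bar>p\<bar> * ((1-l)/l + \<theta>'))\<^sup>2"
    proof -
      have "p * (- ((1-l)/l) - \<theta>') = - (p * ((1-l)/l + \<theta>'))" by (simp add: algebra_simps)
      then have "(p * (- ((1-l)/l) - \<theta>'))\<^sup>2 = (p * ((1-l)/l + \<theta>'))\<^sup>2" by (simp only: power2_minus)
      then show ?thesis unfolding Wsq by (simp only: power_mult_distrib power2_abs)
    qed
    with line[of 0] z[OF l0] show ?thesis by simp
  qed
  then have "\<bar>p\<bar> * ((1-l)/l + \<theta>') \<le> \<delta>"
    using assms(1,2) by (auto dest: power2_le_imp_le)
  then have "\<bar>p\<bar> * ((1-l)/l) \<le> \<delta>"
    using mult_nonneg_nonneg[OF abs_ge_zero[of p] less_imp_le[OF thin(1)]] unfolding distrib_left by linarith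
  then have "\<bar>p\<bar> * (1-l) \<le> \<delta> * l" using l0 by (simp add: field_simps)
  moreover have "\<bar>p\<bar> * (1/2) \<le> \<bar>p\<bar> * (1-l)" using l0 by (intro mult_left_mono) auto
  ultimately have "\<rho> \<le> \<delta> * l" using p2 by linarith
  then have "\<rho> / \<delta> \<le> l" using assms(1,2) by (simp add: field_simps)
  show thesis
  proof (rule that[OF l0])
    show "sqrt (\<delta>\<^sup>2 - \<epsilon>\<^sup>2) / \<delta> \<le> l" using \<open>\<rho> / \<delta> \<le> l\<close> by (simp add: \<rho>_def)
    show "(1-\<theta>) * z2 l + \<theta> * y2 l \<le> ((1-\<theta>) * z1 l + \<theta> * y1 l)\<^sup>2 + \<delta>\<^sup>2" for \<theta>
      using line[of \<theta>] Wsq[of "\<theta> - (1-\<theta>) * ((1-l)/l)"] zero_le_power2[of "p * (\<theta> - (1-\<theta>) * ((1-l)/l) - \<theta>')"] by linarith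
  qed
qed

section \<open>Averages over intervals and the splitting\<close>

definition mean :: "real \<Rightarrow> real \<Rightarrow> (real \<Rightarrow> real) \<Rightarrow> real" where
  "mean u v f = integral {u..v} f / (v - u)"

text \<open>Working form of \<open>BMO_ball\<close> on a closed interval, free of suprema and
  extended reals; \<open>BMO_ball_iff_bmo_le\<close> transfers it to every interval with the same
  endpoints.\<close>

definition bmo_le :: "real \<Rightarrow> real \<Rightarrow> real \<Rightarrow> (real \<Rightarrow> real) \<Rightarrow> bool" where
  "bmo_le \<epsilon> a b \<phi> \<longleftrightarrow> \<phi> absolutely_integrable_on {a..b} \<and> (\<lambda>t. (\<phi> t)\<^sup>2) integrable_on {a..b} \<and>
     (\<forall>u v. a \<le> u \<longrightarrow> u < v \<longrightarrow> v \<le> b \<longrightarrow> mean u v (\<lambda>t. (\<phi> t)\<^sup>2) - (mean u v \<phi>)\<^sup>2 \<le> \<epsilon>\<^sup>2)"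

lemma bmo_le_subinterval:
  assumes "bmo_le \<epsilon> a b \<phi>" "a \<le> u" "v \<le> b"
  shows "bmo_le \<epsilon> u v \<phi>"
  using assms unfolding bmo_le_def
  by (auto intro: absolutely_integrable_on_subinterval integrable_on_subinterval)

lemma bmo_leD:
  assumes "bmo_le \<epsilon> a b \<phi>" "a \<le> u" "v \<le> b"
  shows "\<phi> integrable_on {u..v}" "(\<lambda>t. (\<phi> t)\<^sup>2) integrable_on {u..v}"
    "\<phi> absolutely_integrable_on {u..v}"
    "u < v \<Longrightarrow> mean u v (\<lambda>t. (\<phi> t)\<^sup>2) - (mean u v \<phi>)\<^sup>2 \<le> \<epsilon>\<^sup>2"
  using bmo_le_subinterval[OF assms] unfolding bmo_le_def
  by (auto intro: absolutely_integrable_on_def[THEN iffD1, THEN conjunct1])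

lemma integral_eq_mean: "u < v \<Longrightarrow> integral {u..v} f = (v - u) * mean u v f"
  by (simp add: mean_def)

lemma integral_sq_dev:
  fixes \<phi> :: "real \<Rightarrow> real"
  assumes "u < v" "\<phi> integrable_on {u..v}" "(\<lambda>t. (\<phi> t)\<^sup>2) integrable_on {u..v}"
  shows "(\<lambda>t. (\<phi> t - c)\<^sup>2) integrable_on {u..v}"
    "integral {u..v} (\<lambda>t. (\<phi> t - c)\<^sup>2) = (v - u) * (mean u v (\<lambda>t. (\<phi> t)\<^sup>2) - 2 * c * mean u v \<phi> + c\<^sup>2)"
proof -
  have "((\<lambda>t. (\<phi> t)\<^sup>2 - 2 * c * \<phi> t + c\<^sup>2) has_integral
     (integral {u..v} (\<lambda>t. (\<phi> t)\<^sup>2) - 2 * c * integral {u..v} \<phi> + (v - u) * c\<^sup>2)) {u..v}"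
    using has_integral_const_real[of "c\<^sup>2" u v] assms
    by (intro has_integral_add has_integral_diff has_integral_mult_right integrable_integral) auto
  moreover have "(\<lambda>t. (\<phi> t)\<^sup>2 - 2 * c * \<phi> t + c\<^sup>2) = (\<lambda>t. (\<phi> t - c)\<^sup>2)"
    by (simp add: power2_diff algebra_simps)
  ultimately have "((\<lambda>t. (\<phi> t - c)\<^sup>2) has_integral
     (v - u) * (mean u v (\<lambda>t. (\<phi> t)\<^sup>2) - 2 * c * mean u v \<phi> + c\<^sup>2)) {u..v}"
    using assms(1) by (simp add: integral_eq_mean algebra_simps)
  then show "(\<lambda>t. (\<phi> t - c)\<^sup>2) integrable_on {u..v}"
    "integral {u..v} (\<lambda>t. (\<phi> t - c)\<^sup>2) = (v - u) * (mean u v (\<lambda>t. (\<phi> t)\<^sup>2) - 2 * c * mean u v \<phi> + c\<^sup>2)"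
    by (auto simp: has_integral_iff)
qed

text \<open>The difference of the two sides is the square of \<open>mean u v \<phi> - c\<close>. It
  lets variances be estimated with a convenient constant in place of the mean.\<close>

lemma variance_le_mean_sq_dev:
  fixes \<phi> :: "real \<Rightarrow> real"
  assumes "u < v" "\<phi> integrable_on {u..v}" "(\<lambda>t. (\<phi> t)\<^sup>2) integrable_on {u..v}"
  shows "mean u v (\<lambda>t. (\<phi> t)\<^sup>2) - (mean u v \<phi>)\<^sup>2 \<le> mean u v (\<lambda>t. (\<phi> t - c)\<^sup>2)"
proof -
  have "mean u v (\<lambda>t. (\<phi> t - c)\<^sup>2) = mean u v (\<lambda>t. (\<phi> t)\<^sup>2) - 2 * c * mean u v \<phi> + c\<^sup>2"
    using assms(1) unfolding mean_def[of u v "\<lambda>t. (\<phi> t - c)\<^sup>2"] by (simp add: integral_sq_dev[OF assms])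
  moreover have "0 \<le> (mean u v \<phi> - c)\<^sup>2" by simp
  ultimately show ?thesis unfolding power2_diff[of "mean u v \<phi>"]
    using mult.commute[of c "mean u v \<phi>"] by linarith
qed

lemma variance_eq_mean_sq_dev:
  fixes \<phi> :: "real \<Rightarrow> real"
  assumes "u < v" "\<phi> integrable_on {u..v}" "(\<lambda>t. (\<phi> t)\<^sup>2) integrable_on {u..v}"
  shows "mean u v (\<lambda>t. (\<phi> t - mean u v \<phi>)\<^sup>2) = mean u v (\<lambda>t. (\<phi> t)\<^sup>2) - (mean u v \<phi>)\<^sup>2"
  using assms(1) unfolding mean_def[of u v "\<lambda>t. (\<phi> t - mean u v \<phi>)\<^sup>2"] integral_sq_dev(2)[OF assms]
  by (simp add: power2_eq_square)

lemma mean_power2_le: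
  fixes \<phi> :: "real \<Rightarrow> real"
  assumes "u < v" "\<phi> integrable_on {u..v}" "(\<lambda>t. (\<phi> t)\<^sup>2) integrable_on {u..v}"
  shows "(mean u v \<phi>)\<^sup>2 \<le> mean u v (\<lambda>t. (\<phi> t)\<^sup>2)"
proof -
  have "0 \<le> mean u v (\<lambda>t. (\<phi> t - mean u v \<phi>)\<^sup>2)"
    using assms(1) unfolding mean_def
    by (intro divide_nonneg_nonneg integral_nonneg integral_sq_dev[OF assms]) auto
  then show ?thesis using variance_eq_mean_sq_dev[OF assms] by simp
qed

lemma mean_split:
  assumes "f integrable_on {a..b}" "a < c" "c < b"
  shows "(c - a) * mean a c f + (b - c) * mean c b f = (b - a) * mean a b f"
  using Henstock_Kurzweil_Integration.integral_combine[of a c b f] assms by (simp add: mean_def)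

lemma continuous_on_mean_left:
  fixes f :: "real \<Rightarrow> real"
  assumes "f integrable_on {a..b}" "a < b"
  shows "continuous_on {0..1/2} (\<lambda>l. mean a (b - l * (b - a)) f)"
proof -
  have "0 \<le> l * (b - a)" "l * (b - a) \<le> 1/2 * (b - a)" if "l \<in> {0..1/2}" for l
    using that assms(2) by (auto intro: mult_right_mono)
  then have "b - l * (b - a) \<in> {a..b}" "b - l * (b - a) - a \<noteq> 0" if "l \<in> {0..1/2}" for l
    using that assms(2) by (force simp: field_simps)+
  then show ?thesis unfolding mean_def
    by (intro continuous_intros continuous_on_compose2[OF indefinite_integral_continuous_1[OF assms(1)]]) auto
qed

lemma continuous_on_mean_right:
  fixes f :: "real \<Rightarrow> real"
  assumes "f integrable_on {a..b}" "a < b"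
  shows "continuous_on {0..1/2} (\<lambda>l. mean (a + l * (b - a)) b f)"
proof -
  have "0 \<le> l * (b - a)" "l * (b - a) \<le> 1/2 * (b - a)" if "l \<in> {0..1/2}" for l
    using that assms(2) by (auto intro: mult_right_mono)
  then have "a + l * (b - a) \<in> {a..b}" "b - (a + l * (b - a)) \<noteq> 0" if "l \<in> {0..1/2}" for l
    using that assms(2) by (force simp: field_simps)+
  then show ?thesis unfolding mean_def
    by (intro continuous_intros continuous_on_compose2[OF indefinite_integral_continuous_1'[OF assms(1)]]) auto
qed

text \<open>The midpoint is tried first. If its segment leaves \<open>Omega \<delta>\<close>, the
  point of the whole interval still bisects that segment, so the offending point lies between it and
  the point of one half; that half takes the role of the large part in
  \<open>tangent_splitting\<close>. The small part has a fraction \<open>l \<le> 1/2\<close>, the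
  large one \<open>1 - l \<le> 1 - sqrt (\<delta>\<^sup>2 - \<epsilon>\<^sup>2) / \<delta>\<close>,
  and \<open>q\<close> dominates both.\<close>

lemma bmo_splitting:
  assumes bmo: "bmo_le \<epsilon> a b \<phi>" and ab: "a < b" and "0 \<le> \<epsilon>" "\<epsilon> < \<delta>"
  defines "q \<equiv> max (1/2) (1 - sqrt (\<delta>\<^sup>2 - \<epsilon>\<^sup>2) / \<delta>)"
  obtains c where "a < c" "c < b" "c - a \<le> q * (b - a)" "b - c \<le> q * (b - a)"
    "\<And>\<theta>. \<theta> \<in> {0..1} \<Longrightarrow> (1-\<theta>) * mean a c (\<lambda>t. (\<phi> t)\<^sup>2) + \<theta> * mean c b (\<lambda>t. (\<phi> t)\<^sup>2)
       \<le> ((1-\<theta>) * mean a c \<phi> + \<theta> * mean c b \<phi>)\<^sup>2 + \<delta>\<^sup>2"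
proof -
  let ?f = "\<lambda>t. (\<phi> t)\<^sup>2"
  define m where "m = (a + b) / 2"
  have m: "a < m" "m < b" "m = b - 1/2 * (b - a)" "m = a + 1/2 * (b - a)"
    using ab by (auto simp: m_def field_simps)
  note int = bmo_leD(1,2)[OF bmo order.refl order.refl]
  have q: "1/2 \<le> q" "1 - sqrt (\<delta>\<^sup>2 - \<epsilon>\<^sup>2) / \<delta> \<le> q" by (auto simp: q_def)
  have halves: "mean a m f + mean m b f = 2 * mean a b f" if "f integrable_on {a..b}" for f
  proof -
    have e: "b - m = m - a" "b - a = (m - a) * 2" by (auto simp: m_def field_simps)
    have "(m - a) * (mean a m f + mean m b f) = (m - a) * (2 * mean a b f)"
      using mean_split[OF that m(1,2)] unfolding e by (simp add: algebra_simps)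
    with m(1) show ?thesis by simp
  qed
  have upper: "mean u v ?f \<le> (mean u v \<phi>)\<^sup>2 + \<epsilon>\<^sup>2" if "a \<le> u" "u < v" "v \<le> b" for u v
    using bmo_leD(4)[OF bmo that(1,3,2)] by simp
  have lower: "(mean u v \<phi>)\<^sup>2 \<le> mean u v ?f" if "a \<le> u" "u < v" "v \<le> b" for u v
    using mean_power2_le[OF that(2)] bmo_leD(1,2)[OF bmo that(1,3)] by blast
  have lt: "l * (b - a) < b - a" if "l \<le> 1/2" for l
    using mult_strict_right_mono[of l 1 "b - a"] that ab by simp
  have lpos: "0 < l * (b - a)" "a + l * (b - a) < b" "a < b - l * (b - a)" if "l \<in> {0<..1/2}" for l
  proof -
    have "0 < l" "l \<le> 1/2" using that by auto
    with lt[of l] ab mult_pos_pos[of l "b - a"]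
    show "0 < l * (b - a)" "a + l * (b - a) < b" "a < b - l * (b - a)" by linarith+
  qed
  have lpos': "a \<le> a + l * (b - a)" "a + l * (b - a) < b" "a < b - l * (b - a)" "b - l * (b - a) \<le> b"
    if "l \<in> {0..1/2}" for l
  proof -
    have "0 \<le> l" "l \<le> 1/2" using that by auto
    with lt[of l] ab mult_nonneg_nonneg[of l "b - a"]
    show "a \<le> a + l * (b - a)" "a + l * (b - a) < b" "a < b - l * (b - a)" "b - l * (b - a) \<le> b" by linarith+
  qed
  have ld: "1 - l \<le> q \<Longrightarrow> (b - a) - l * (b - a) \<le> q * (b - a)" "l \<le> q \<Longrightarrow> l * (b - a) \<le> q * (b - a)" for l
    using mult_right_mono[of "1 - l" q "b - a"] mult_right_mono[of l q "b - a"] ab by (auto simp: algebra_simps)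
  show thesis
  proof (cases "\<forall>\<theta>\<in>{0..1}. (1-\<theta>) * mean a m ?f + \<theta> * mean m b ?f
       \<le> ((1-\<theta>) * mean a m \<phi> + \<theta> * mean m b \<phi>)\<^sup>2 + \<delta>\<^sup>2")
    case True
    have "m - a = 1/2 * (b - a)" "b - m = 1/2 * (b - a)" by (auto simp: m_def field_simps)
    moreover have "1/2 * (b - a) \<le> q * (b - a)" using q ab by (intro mult_right_mono) auto
    ultimately show ?thesis using True that[OF m(1,2)] by auto
  next
    case False
    then obtain \<theta> where th: "\<theta> \<in> {0..1}" and bad: "(1-\<theta>) * mean a m ?f + \<theta> * mean m b ?f
       > ((1-\<theta>) * mean a m \<phi> + \<theta> * mean m b \<phi>)\<^sup>2 + \<delta>\<^sup>2" by force
    show ?thesis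
    proof (cases "\<theta> \<ge> 1/2")
      case True
      \<comment> \<open>The offending point is on the right half of the segment;
        \<open>2 * \<theta> - 1\<close> is its parameter when that half is rescaled to start at the
        point of the whole interval.\<close>
      have conv: "(1-\<theta>) * mean a m f + \<theta> * mean m b f = (1 - (2*\<theta>-1)) * mean a b f + (2*\<theta>-1) * mean m b f"
        if "f integrable_on {a..b}" for f
      proof -
        have "mean a m f = 2 * mean a b f - mean m b f" using halves[OF that] by simp
        then show ?thesis by (simp only:) (simp add: algebra_simps)
      qed
      obtain l where l: "l \<in> {0<..1/2}" "l \<ge> sqrt (\<delta>\<^sup>2 - \<epsilon>\<^sup>2) / \<delta>" and
        seg: "\<And>\<theta>. (1-\<theta>) * mean a (a + l * (b-a)) ?f + \<theta> * mean (a + l * (b-a)) b ?f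
          \<le> ((1-\<theta>) * mean a (a + l * (b-a)) \<phi> + \<theta> * mean (a + l * (b-a)) b \<phi>)\<^sup>2 + \<delta>\<^sup>2"
      proof (rule tangent_splitting[where ?\<epsilon> = \<epsilon> and ?\<delta> = \<delta>
            and ?y1.0 = "\<lambda>l. mean (a + l * (b-a)) b \<phi>" and ?y2.0 = "\<lambda>l. mean (a + l * (b-a)) b ?f"
            and ?z1.0 = "\<lambda>l. mean a (a + l * (b-a)) \<phi>" and ?z2.0 = "\<lambda>l. mean a (a + l * (b-a)) ?f"
            and ?x1.0 = "mean a b \<phi>" and ?x2.0 = "mean a b ?f" and ?\<theta>0.0 = "2*\<theta>-1"])
        show "(1 - (2*\<theta>-1)) * mean a b ?f + (2*\<theta>-1) * mean (a + 1/2 * (b-a)) b ?f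
           > ((1 - (2*\<theta>-1)) * mean a b \<phi> + (2*\<theta>-1) * mean (a + 1/2 * (b-a)) b \<phi>)\<^sup>2 + \<delta>\<^sup>2"
          using bad unfolding conv[OF int(1)] conv[OF int(2)] m(4)[symmetric] .
        show "l * mean a (a + l * (b-a)) \<phi> + (1-l) * mean (a + l * (b-a)) b \<phi> = mean a b \<phi>"
             "l * mean a (a + l * (b-a)) ?f + (1-l) * mean (a + l * (b-a)) b ?f = mean a b ?f"
          if "l \<in> {0<..1/2}" for l
        proof -
          have *: "l * X + (1-l) * Y = Z" if "(a + l * (b-a) - a) * X + (b - (a + l * (b-a))) * Y = (b - a) * Z" for X Y Z
          proof -
            have "(b - a) * (l * X + (1-l) * Y) = (b - a) * Z" using that by (simp add: algebra_simps)
            then show ?thesis using ab by simp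
          qed
          show "l * mean a (a + l * (b-a)) \<phi> + (1-l) * mean (a + l * (b-a)) b \<phi> = mean a b \<phi>"
            using lpos[OF that] ab by (intro * mean_split int) auto
          show "l * mean a (a + l * (b-a)) ?f + (1-l) * mean (a + l * (b-a)) b ?f = mean a b ?f"
            using lpos[OF that] ab by (intro * mean_split int) auto
        qed
        show "mean (a + l * (b-a)) b ?f \<le> (mean (a + l * (b-a)) b \<phi>)\<^sup>2 + \<epsilon>\<^sup>2" if "l \<in> {0..1/2}" for l
          using lpos'[OF that] ab by (intro upper) auto
        show "(mean a (a + l * (b-a)) \<phi>)\<^sup>2 \<le> mean a (a + l * (b-a)) ?f" if "l \<in> {0<..1/2}" for l
          using lpos[OF that] ab by (intro lower) auto
      qed (use assms(3,4) True th in \<open>auto intro: continuous_on_mean_right[OF int(1) ab] continuous_on_mean_right[OF int(2) ab]\<close>)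
      show ?thesis
        using lpos[OF l(1)] ab l ld[of l] q seg
        by (intro that[of "a + l * (b-a)"]) auto
    next
      case False
      \<comment> \<open>Mirror image: the left half of the segment is run through from the point of
        the whole interval to that of \<open>{a..m}\<close>.\<close>
      have conv: "(1-\<theta>) * mean a m f + \<theta> * mean m b f = (1 - (1-2*\<theta>)) * mean a b f + (1-2*\<theta>) * mean a m f"
        if "f integrable_on {a..b}" for f
      proof -
        have "mean m b f = 2 * mean a b f - mean a m f" using halves[OF that] by simp
        then show ?thesis by (simp only:) (simp add: algebra_simps)
      qed
      obtain l where l: "l \<in> {0<..1/2}" "l \<ge> sqrt (\<delta>\<^sup>2 - \<epsilon>\<^sup>2) / \<delta>" and
        seg: "\<And>\<theta>. (1-\<theta>) * mean (b - l * (b-a)) b ?f + \<theta> * mean a (b - l * (b-a)) ?f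
          \<le> ((1-\<theta>) * mean (b - l * (b-a)) b \<phi> + \<theta> * mean a (b - l * (b-a)) \<phi>)\<^sup>2 + \<delta>\<^sup>2"
      proof (rule tangent_splitting[where ?\<epsilon> = \<epsilon> and ?\<delta> = \<delta>
            and ?y1.0 = "\<lambda>l. mean a (b - l * (b-a)) \<phi>" and ?y2.0 = "\<lambda>l. mean a (b - l * (b-a)) ?f"
            and ?z1.0 = "\<lambda>l. mean (b - l * (b-a)) b \<phi>" and ?z2.0 = "\<lambda>l. mean (b - l * (b-a)) b ?f"
            and ?x1.0 = "mean a b \<phi>" and ?x2.0 = "mean a b ?f" and ?\<theta>0.0 = "1-2*\<theta>"])
        show "(1 - (1-2*\<theta>)) * mean a b ?f + (1-2*\<theta>) * mean a (b - 1/2 * (b-a)) ?f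
           > ((1 - (1-2*\<theta>)) * mean a b \<phi> + (1-2*\<theta>) * mean a (b - 1/2 * (b-a)) \<phi>)\<^sup>2 + \<delta>\<^sup>2"
          using bad unfolding conv[OF int(1)] conv[OF int(2)] m(3)[symmetric] .
        show "l * mean (b - l * (b-a)) b \<phi> + (1-l) * mean a (b - l * (b-a)) \<phi> = mean a b \<phi>"
             "l * mean (b - l * (b-a)) b ?f + (1-l) * mean a (b - l * (b-a)) ?f = mean a b ?f"
          if "l \<in> {0<..1/2}" for l
        proof -
          have *: "l * Y + (1-l) * X = Z" if "(b - l * (b-a) - a) * X + (b - (b - l * (b-a))) * Y = (b - a) * Z" for X Y Z
          proof -
            have "(b - a) * (l * Y + (1-l) * X) = (b - a) * Z" using that by (simp add: algebra_simps)
            then show ?thesis using ab by simp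
          qed
          show "l * mean (b - l * (b-a)) b \<phi> + (1-l) * mean a (b - l * (b-a)) \<phi> = mean a b \<phi>"
            using lpos[OF that] ab by (intro * mean_split int) auto
          show "l * mean (b - l * (b-a)) b ?f + (1-l) * mean a (b - l * (b-a)) ?f = mean a b ?f"
            using lpos[OF that] ab by (intro * mean_split int) auto
        qed
        show "mean a (b - l * (b-a)) ?f \<le> (mean a (b - l * (b-a)) \<phi>)\<^sup>2 + \<epsilon>\<^sup>2" if "l \<in> {0..1/2}" for l
          using lpos'[OF that] ab by (intro upper) auto
        show "(mean (b - l * (b-a)) b \<phi>)\<^sup>2 \<le> mean (b - l * (b-a)) b ?f" if "l \<in> {0<..1/2}" for l
          using lpos[OF that] ab by (intro lower) auto
      qed (use assms(3,4) False th in \<open>auto intro: continuous_on_mean_left[OF int(1) ab] continuous_on_mean_left[OF int(2) ab]\<close>)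
      have "(1-\<theta>) * mean a (b - l * (b-a)) ?f + \<theta> * mean (b - l * (b-a)) b ?f
          \<le> ((1-\<theta>) * mean a (b - l * (b-a)) \<phi> + \<theta> * mean (b - l * (b-a)) b \<phi>)\<^sup>2 + \<delta>\<^sup>2" for \<theta>
        using seg[of "1 - \<theta>"] by (simp add: add.commute)
      then show ?thesis
        using lpos[OF l(1)] ab l ld[of l] q
        by (intro that[of "b - l * (b-a)"]) auto
    qed
  qed
qed

text \<open>The point of the whole interval divides the segment in proportion to the lengths of the
  parts. Multiplying concavity by the length makes it superadditivity of \<open>G\<close>, which can
  be iterated without tracking weights.\<close>

lemma Bell_superadditive_splitting:
  assumes bmo: "bmo_le \<epsilon> a b \<phi>" and ab: "a < b" and "0 \<le> \<epsilon>" "\<epsilon> < \<delta>"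
    and \<sigma>: "\<sigma>\<^sup>2 = 1" "\<sigma> * \<delta> < 1"
  defines "q \<equiv> max (1/2) (1 - sqrt (\<delta>\<^sup>2 - \<epsilon>\<^sup>2) / \<delta>)"
  defines "G \<equiv> (\<lambda>u v. (v - u) * (\<sigma> * Bell \<sigma> \<delta> (mean u v \<phi>) (mean u v (\<lambda>t. (\<phi> t)\<^sup>2))))"
  obtains c where "a < c" "c < b" "c - a \<le> q * (b - a)" "b - c \<le> q * (b - a)"
    "G a c + G c b \<le> G a b"
proof -
  let ?f = "\<lambda>t. (\<phi> t)\<^sup>2"
  obtain c where c: "a < c" "c < b" "c - a \<le> q * (b - a)" "b - c \<le> q * (b - a)"
    and seg: "\<And>\<theta>. \<theta> \<in> {0..1} \<Longrightarrow> (1-\<theta>) * mean a c ?f + \<theta> * mean c b ?f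
       \<le> ((1-\<theta>) * mean a c \<phi> + \<theta> * mean c b \<phi>)\<^sup>2 + \<delta>\<^sup>2"
    using bmo_splitting[OF assms(1-4)] unfolding q_def by metis
  define t where "t = (b - c) / (b - a)"
  have t: "t \<in> {0..1}" "1 - t = (c - a) / (b - a)" using c by (auto simp: t_def field_simps)
  have mt: "(1-t) * mean a c f + t * mean c b f = mean a b f" if "f integrable_on {a..b}" for f
  proof -
    have "(1-t) * mean a c f + t * mean c b f = ((c - a) * mean a c f + (b - c) * mean c b f) / (b - a)"
      unfolding t(2) unfolding t_def by (simp add: add_divide_distrib)
    then show ?thesis unfolding mean_split[OF that c(1,2)] using ab by simp
  qed
  note int = bmo_leD(1,2)[OF bmo order.refl order.refl]
  have "(1 - t) * (\<sigma> * Bell \<sigma> \<delta> (mean a c \<phi>) (mean a c ?f)) + t * (\<sigma> * Bell \<sigma> \<delta> (mean c b \<phi>) (mean c b ?f))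
     \<le> \<sigma> * Bell \<sigma> \<delta> (mean a b \<phi>) (mean a b ?f)"
    using Bell_concave_segment[OF \<sigma> seg t(1)] unfolding mt[OF int(1)] mt[OF int(2)] .
  from mult_left_mono[OF this, of "b - a"] ab
  have "(b - a) * ((1 - t) * (\<sigma> * Bell \<sigma> \<delta> (mean a c \<phi>) (mean a c ?f)) + t * (\<sigma> * Bell \<sigma> \<delta> (mean c b \<phi>) (mean c b ?f))) \<le> G a b"
    by (simp add: G_def)
  moreover have "(b - a) * ((1 - t) * X + t * Y) = (c - a) * X + (b - c) * Y" for X Y
  proof -
    have "(b - a) * ((1 - t) * X + t * Y) = ((b - a) * (1 - t)) * X + ((b - a) * t) * Y"
      by (simp only: distrib_left mult.assoc)
    then show ?thesis unfolding t(2) unfolding t_def using ab by simp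
  qed
  ultimately show thesis using that[OF c] by (simp add: G_def)
qed

section \<open>Bellman induction for bounded functions\<close>

lemma exp_lipschitz:
  fixes x y M :: real
  assumes "x \<le> M" "y \<le> M"
  shows "\<bar>exp x - exp y\<bar> \<le> exp M * \<bar>x - y\<bar>"
proof -
  have *: "exp v - exp u \<le> exp M * (v - u)" if "u \<le> v" "v \<le> M" for u v :: real
  proof -
    have "exp v * (1 - (v - u)) \<le> exp v * exp (u - v)"
    proof (rule mult_left_mono)
      show "1 - (v - u) \<le> exp (u - v)" using exp_ge_add_one_self[of "u - v"] by linarith
    qed auto
    also have "\<dots> = exp u" by (simp flip: exp_add)
    finally have "exp v - exp u \<le> exp v * (v - u)" by (simp add: algebra_simps)
    also have "\<dots> \<le> exp M * (v - u)" using that by (intro mult_right_mono) auto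
    finally show ?thesis .
  qed
  show ?thesis
    using *[of x y] *[of y x] assms exp_le_cancel_iff[of x y] by (cases "x \<le> y") (auto simp: abs_if)
qed

text \<open>On \<open>x2 = x1\<^sup>2\<close> the candidate equals \<open>exp x1\<close>. For
  \<sigma> = 1 it only grows away from there, as \<open>(1 - s) * exp s\<close> decreases in
  \<open>s\<close>. For \<sigma> = -1 growth is the wrong direction, and the increase is paid for by
  a multiple of the variance: \<open>(1 + s) * exp (- s) + s\<^sup>2 / 2\<close> increases in
  \<open>s\<close>.\<close>

lemma exp_le_Bell:
  fixes \<sigma> \<delta> M x1 x2 :: real
  assumes \<sigma>: "\<sigma> = 1 \<or> \<sigma> = -1" "\<sigma> * \<delta> < 1" and "0 \<le> \<delta>"
    and x: "x1\<^sup>2 \<le> x2" "x2 \<le> x1\<^sup>2 + \<delta>\<^sup>2" "x1 \<le> M"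
  shows "\<sigma> * exp x1 \<le> \<sigma> * Bell \<sigma> \<delta> x1 x2 + exp (M + \<delta>) * (x2 - x1\<^sup>2)"
proof -
  define s where "s = sqrt (\<delta>\<^sup>2 + x1\<^sup>2 - x2)"
  have s: "0 \<le> s" "s \<le> \<delta>" unfolding s_def using x \<open>0 \<le> \<delta>\<close> by (auto intro: real_le_lsqrt)
  have s2: "\<delta>\<^sup>2 - s\<^sup>2 = x2 - x1\<^sup>2" unfolding s_def using x by simp
  have Bell: "Bell \<sigma> \<delta> x1 x2 = exp x1 * ((1 - \<sigma> * s) * exp (\<sigma> * s) / ((1 - \<sigma> * \<delta>) * exp (\<sigma> * \<delta>)))"
    unfolding Bell_def s_def[symmetric] by (simp add: exp_add exp_diff)
  from \<sigma>(1) show ?thesis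
  proof
    assume [simp]: "\<sigma> = 1"
    have "(1 - \<delta>) * exp \<delta> \<le> (1 - s) * exp s"
    proof (rule DERIV_nonpos_imp_nonincreasing[OF s(2)])
      fix t assume "s \<le> t"
      then show "\<exists>y. ((\<lambda>t. (1 - t) * exp t) has_real_derivative y) (at t) \<and> y \<le> 0"
        using s(1) by (intro exI[of _ "- t * exp t"]) (auto intro!: derivative_eq_intros simp: algebra_simps)
    qed
    then have "1 \<le> (1 - s) * exp s / ((1 - \<delta>) * exp \<delta>)" using \<sigma> by simp
    from mult_left_mono[OF this, of "exp x1"] have "exp x1 \<le> Bell \<sigma> \<delta> x1 x2" unfolding Bell by simp
    moreover have "0 \<le> exp (M + \<delta>) * (x2 - x1\<^sup>2)" using x by simp
    ultimately show ?thesis unfolding \<open>\<sigma> = 1\<close> by simp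
  next
    assume [simp]: "\<sigma> = -1"
    have "(1 + s) * exp (- s) + s\<^sup>2 / 2 \<le> (1 + \<delta>) * exp (- \<delta>) + \<delta>\<^sup>2 / 2"
    proof (rule DERIV_nonneg_imp_nondecreasing[OF s(2)])
      fix t assume "s \<le> t"
      then have "t * exp (- t) \<le> t * 1" using s(1) by (intro mult_left_mono) auto
      then show "\<exists>y. ((\<lambda>t. (1 + t) * exp (- t) + t\<^sup>2 / 2) has_real_derivative y) (at t) \<and> 0 \<le> y"
        by (intro exI[of _ "t - t * exp (- t)"]) (auto intro!: derivative_eq_intros simp: algebra_simps)
    qed
    then have le: "(1 + s) * exp (- s) \<le> (1 + \<delta>) * exp (- \<delta>) + (x2 - x1\<^sup>2) / 2"
      unfolding s2[symmetric] by (simp add: diff_divide_distrib)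
    have pos: "0 < (1 + \<delta>) * exp (- \<delta>)" using \<open>0 \<le> \<delta>\<close> by simp
    have "(1 + s) * exp (- s) / ((1 + \<delta>) * exp (- \<delta>))
      \<le> ((1 + \<delta>) * exp (- \<delta>) + (x2 - x1\<^sup>2) / 2) / ((1 + \<delta>) * exp (- \<delta>))"
      using pos by (intro divide_right_mono[OF le]) auto
    also have "\<dots> = 1 + (x2 - x1\<^sup>2) * (exp \<delta> * (1 / (2 * (1 + \<delta>))))"
    proof -
      have "(A + B / 2) / A = 1 + B * (1 / (2 * A))" if "A > 0" for A B :: real
        using that by (simp add: field_simps)
      from this[OF pos, of "x2 - x1\<^sup>2"] show ?thesis by (simp add: exp_minus field_simps)
    qed
    also have "\<dots> \<le> 1 + (x2 - x1\<^sup>2) * (exp \<delta> * 1)"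
      using x \<open>0 \<le> \<delta>\<close> by (intro add_left_mono mult_left_mono) (auto simp: field_simps)
    finally have "Bell \<sigma> \<delta> x1 x2 \<le> exp x1 * (1 + (x2 - x1\<^sup>2) * exp \<delta>)"
      unfolding Bell by (intro mult_left_mono) auto
    also have "\<dots> = exp x1 + exp (x1 + \<delta>) * (x2 - x1\<^sup>2)" by (simp add: exp_add algebra_simps)
    also have "\<dots> \<le> exp x1 + exp (M + \<delta>) * (x2 - x1\<^sup>2)"
      using x by (intro add_left_mono mult_right_mono) auto
    finally show ?thesis by (simp only: \<open>\<sigma> = -1\<close>)
  qed
qed

section \<open>Approximation in mean and the error on a small interval\<close>

lemma integrable_bounded_compose:
  fixes \<phi> :: "real \<Rightarrow> real" and h :: "real \<Rightarrow> real"
  assumes "\<phi> absolutely_integrable_on {u..v}" "h \<in> borel_measurable borel"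
    and "\<And>t. t \<in> {u..v} \<Longrightarrow> \<bar>h (\<phi> t)\<bar> \<le> C"
  shows "(\<lambda>t. h (\<phi> t)) absolutely_integrable_on {u..v}"
proof (rule measurable_bounded_by_integrable_imp_absolutely_integrable)
  have "\<phi> \<in> borel_measurable (lebesgue_on {u..v})"
    using assms(1) by (rule absolutely_integrable_imp_borel_measurable) auto
  then show "(\<lambda>t. h (\<phi> t)) \<in> borel_measurable (lebesgue_on {u..v})"
    using assms(2) by (rule measurable_compose)
qed (use assms(3) in auto)

text \<open>Measurability provides continuous functions converging off a null set; clamping them to
  the range of \<phi> keeps continuity and gives the dominating constant
  \<open>2 * M\<close>.\<close>

lemma L1_approx_continuous:
  fixes \<phi> :: "real \<Rightarrow> real"
  assumes \<phi>: "\<phi> absolutely_integrable_on {a..b}" and M: "\<And>t. t \<in> {a..b} \<Longrightarrow> \<bar>\<phi> t\<bar> \<le> M" and "e > 0"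
  obtains g where "continuous_on {a..b} g" "(\<lambda>t. \<bar>\<phi> t - g t\<bar>) integrable_on {a..b}"
    "integral {a..b} (\<lambda>t. \<bar>\<phi> t - g t\<bar>) < e"
proof -
  have "\<phi> measurable_on {a..b}"
    using absolutely_integrable_imp_borel_measurable[OF \<phi>] by (simp add: measurable_on_iff_borel_measurable)
  then obtain N g where N: "negligible N" and g: "\<And>n. continuous_on UNIV (g n)"
    and lim: "\<And>x. x \<notin> N \<Longrightarrow> (\<lambda>n. g n x) \<longlonglongrightarrow> (if x \<in> {a..b} then \<phi> x else 0)"
    unfolding measurable_on_def by metis
  define G where "G n x = max (- M) (min M (g n x))" for n x
  have G: "continuous_on {a..b} (G n)" for n
    unfolding G_def by (intro continuous_intros continuous_on_subset[OF g]) auto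
  have int: "(\<lambda>t. \<bar>\<phi> t - G n t\<bar>) integrable_on {a..b}" for n
  proof -
    have "(\<lambda>t. \<phi> t - G n t) absolutely_integrable_on {a..b}"
      using \<phi> absolutely_integrable_continuous_real[OF G] by (rule set_integral_diff)
    then show ?thesis by (simp add: absolutely_integrable_on_def)
  qed
  \<comment> \<open>Set to 0 on the null set, because dominated convergence is applied with
    convergence at every point.\<close>
  define h where "h n x = (if x \<in> N then 0 else \<bar>\<phi> x - G n x\<bar>)" for n x
  have "(\<lambda>n. integral {a..b} (h n)) \<longlonglongrightarrow> integral {a..b} (\<lambda>x. 0::real)"
  proof (rule dominated_convergence(2))
    show "h n integrable_on {a..b}" for n
      using N by (rule integrable_spike[OF int[of n]]) (auto simp: h_def)
    show "(\<lambda>x. 2 * M) integrable_on {a..b}" by auto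
    show "norm (h n x) \<le> 2 * M" if "x \<in> {a..b}" for n x
      using M[OF that] by (auto simp: h_def G_def)
    show "(\<lambda>n. h n x) \<longlonglongrightarrow> 0" if "x \<in> {a..b}" for x
    proof (cases "x \<in> N")
      case False
      have "(\<lambda>n. \<bar>\<phi> x - G n x\<bar>) \<longlonglongrightarrow> \<bar>\<phi> x - max (- M) (min M (\<phi> x))\<bar>"
        unfolding G_def using lim[OF False] that by (intro tendsto_intros) auto
      moreover have "max (- M) (min M (\<phi> x)) = \<phi> x" using M[OF that] by auto
      ultimately show ?thesis using False by (simp add: h_def)
    qed (simp add: h_def)
  qed
  moreover have "integral {a..b} (h n) = integral {a..b} (\<lambda>t. \<bar>\<phi> t - G n t\<bar>)" for n
    using N by (rule integral_spike) (auto simp: h_def)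
  ultimately have "(\<lambda>n. integral {a..b} (\<lambda>t. \<bar>\<phi> t - G n t\<bar>)) \<longlonglongrightarrow> 0" by simp
  then have "\<forall>\<^sub>F n in sequentially. integral {a..b} (\<lambda>t. \<bar>\<phi> t - G n t\<bar>) < e"
    using \<open>e > 0\<close> by (rule order_tendstoD(2))
  then obtain n where "integral {a..b} (\<lambda>t. \<bar>\<phi> t - G n t\<bar>) < e"
    unfolding eventually_sequentially by blast
  with G int that show thesis by blast
qed

lemma absolutely_integrable_diff_const:
  fixes \<phi> :: "real \<Rightarrow> real"
  assumes "\<phi> absolutely_integrable_on {u..v}"
  shows "(\<lambda>t. \<bar>\<phi> t - c\<bar>) integrable_on {u..v}" "(\<lambda>t. \<phi> t - c) integrable_on {u..v}"
proof -
  have "(\<lambda>t. \<phi> t - c) absolutely_integrable_on {u..v}"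
    using assms by (rule set_integral_diff) auto
  then show "(\<lambda>t. \<bar>\<phi> t - c\<bar>) integrable_on {u..v}" "(\<lambda>t. \<phi> t - c) integrable_on {u..v}"
    by (simp_all add: absolutely_integrable_on_def)
qed

text \<open>The deviation from the constant \<open>g u\<close> is at most the distance to
  \<open>g\<close> plus the oscillation; replacing \<open>g u\<close> by the mean costs the same
  amount once more, whence the factor 2.\<close>

lemma integral_abs_dev_mean_le:
  fixes \<phi> g :: "real \<Rightarrow> real"
  assumes "u < v" and \<phi>: "\<phi> absolutely_integrable_on {u..v}"
    and g: "(\<lambda>t. \<bar>\<phi> t - g t\<bar>) integrable_on {u..v}"
    and osc: "\<And>s t. s \<in> {u..v} \<Longrightarrow> t \<in> {u..v} \<Longrightarrow> \<bar>g s - g t\<bar> \<le> \<kappa>"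
  shows "integral {u..v} (\<lambda>t. \<bar>\<phi> t - mean u v \<phi>\<bar>) \<le> 2 * integral {u..v} (\<lambda>t. \<bar>\<phi> t - g t\<bar>) + 2 * \<kappa> * (v - u)"
proof -
  define c where "c = g u"
  note i = absolutely_integrable_diff_const[OF \<phi>]
  let ?I = "integral {u..v}"
  have const: "?I (\<lambda>t. k) = k * (v - u)" for k :: real
    using \<open>u < v\<close> by simp
  have 1: "?I (\<lambda>t. \<bar>\<phi> t - c\<bar>) \<le> ?I (\<lambda>t. \<bar>\<phi> t - g t\<bar>) + \<kappa> * (v - u)"
  proof -
    have "?I (\<lambda>t. \<bar>\<phi> t - c\<bar>) \<le> ?I (\<lambda>t. \<bar>\<phi> t - g t\<bar> + \<kappa>)"
    proof (rule integral_le)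
      show "\<bar>\<phi> t - c\<bar> \<le> \<bar>\<phi> t - g t\<bar> + \<kappa>" if "t \<in> {u..v}" for t
        using osc[OF that, of u] \<open>u < v\<close> unfolding c_def by auto
    qed (auto intro!: i g integrable_add)
    also have "\<dots> = ?I (\<lambda>t. \<bar>\<phi> t - g t\<bar>) + \<kappa> * (v - u)"
      using g const[of \<kappa>] by (subst Henstock_Kurzweil_Integration.integral_add) auto
    finally show ?thesis .
  qed
  have "?I (\<lambda>t. \<phi> t - c) = (mean u v \<phi> - c) * (v - u)"
    using \<open>u < v\<close> const[of c] set_lebesgue_integral_eq_integral(1)[OF \<phi>]
    by (subst Henstock_Kurzweil_Integration.integral_diff) (auto simp: mean_def field_simps)
  moreover have "\<bar>?I (\<lambda>t. \<phi> t - c)\<bar> \<le> ?I (\<lambda>t. \<bar>\<phi> t - c\<bar>)"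
    using integral_norm_bound_integral[OF i(2) i(1)] by simp
  ultimately have 2: "\<bar>c - mean u v \<phi>\<bar> * (v - u) \<le> ?I (\<lambda>t. \<bar>\<phi> t - c\<bar>)"
    using \<open>u < v\<close> by (simp add: abs_mult abs_minus_commute)
  have "?I (\<lambda>t. \<bar>\<phi> t - mean u v \<phi>\<bar>) \<le> ?I (\<lambda>t. \<bar>\<phi> t - c\<bar> + \<bar>c - mean u v \<phi>\<bar>)"
    by (rule integral_le) (auto intro!: i integrable_add)
  also have "\<dots> = ?I (\<lambda>t. \<bar>\<phi> t - c\<bar>) + \<bar>c - mean u v \<phi>\<bar> * (v - u)"
    by (subst Henstock_Kurzweil_Integration.integral_add[OF i(1) integrable_const_ivl]) (simp only: const)
  finally show ?thesis using 1 2 by linarith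
qed

text \<open>Both errors are turned into the mean absolute deviation: \<open>exp\<close> is Lipschitz
  with constant \<open>exp M\<close> below \<open>M\<close>, and the variance term of
  \<open>exp_le_Bell\<close> is controlled by
  \<open>\<bar>\<phi> t - m\<bar> \<le> 2 * M\<close>.\<close>

lemma Bell_leaf_estimate:
  fixes \<phi> :: "real \<Rightarrow> real"
  assumes bmo: "bmo_le \<epsilon> u v \<phi>" and uv: "u < v" and \<delta>: "0 \<le> \<epsilon>" "\<epsilon> \<le> \<delta>"
    and \<sigma>: "\<sigma> = 1 \<or> \<sigma> = -1" "\<sigma> * \<delta> < 1"
    and M: "\<And>t. t \<in> {u..v} \<Longrightarrow> \<bar>\<phi> t\<bar> \<le> M"
  shows "\<sigma> * integral {u..v} (\<lambda>t. exp (\<phi> t))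
     \<le> (v - u) * (\<sigma> * Bell \<sigma> \<delta> (mean u v \<phi>) (mean u v (\<lambda>t. (\<phi> t)\<^sup>2)))
       + (exp M + exp (M + \<delta>) * (2 * M)) * integral {u..v} (\<lambda>t. \<bar>\<phi> t - mean u v \<phi>\<bar>)"
proof -
  let ?I = "integral {u..v}"
  define m where "m = mean u v \<phi>"
  define m2 where "m2 = mean u v (\<lambda>t. (\<phi> t)\<^sup>2)"
  note int = bmo_leD[OF bmo order.refl order.refl]
  note i = absolutely_integrable_diff_const[OF int(3)]
  have ei: "(\<lambda>t. exp (\<phi> t)) absolutely_integrable_on {u..v}"
  proof (rule integrable_bounded_compose[OF int(3)])
    show "\<bar>exp (\<phi> t)\<bar> \<le> exp M" if "t \<in> {u..v}" for t using M[OF that] by auto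
  qed auto
  note ei' = absolutely_integrable_diff_const[OF ei]
  have Mm: "\<bar>m\<bar> \<le> M"
  proof -
    have "\<bar>?I \<phi>\<bar> \<le> ?I (\<lambda>t. M)"
      using integral_norm_bound_integral[OF int(1) integrable_const_ivl, of M] M by auto
    then show ?thesis using uv by (simp add: m_def mean_def field_simps)
  qed
  have Msq: "m2 - m\<^sup>2 = ?I (\<lambda>t. (\<phi> t - m)\<^sup>2) / (v - u)"
    using variance_eq_mean_sq_dev[OF uv int(1,2)] by (simp add: m_def m2_def mean_def)
  have "?I (\<lambda>t. (\<phi> t - m)\<^sup>2) \<le> ?I (\<lambda>t. 2 * M * \<bar>\<phi> t - m\<bar>)"
  proof (rule integral_le)
    show "(\<lambda>t. (\<phi> t - m)\<^sup>2) integrable_on {u..v}" by (rule integral_sq_dev(1)[OF uv int(1,2)])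
    show "(\<lambda>t. 2 * M * \<bar>\<phi> t - m\<bar>) integrable_on {u..v}" by (intro integrable_on_mult_right i)
    fix t assume "t \<in> {u..v}"
    from M[OF this] Mm have "\<bar>\<phi> t - m\<bar> \<le> 2 * M" by linarith
    then have "\<bar>\<phi> t - m\<bar> * \<bar>\<phi> t - m\<bar> \<le> 2 * M * \<bar>\<phi> t - m\<bar>" by (intro mult_right_mono) auto
    then show "(\<phi> t - m)\<^sup>2 \<le> 2 * M * \<bar>\<phi> t - m\<bar>" by (simp add: power2_eq_square)
  qed
  then have var: "(v - u) * (m2 - m\<^sup>2) \<le> 2 * M * ?I (\<lambda>t. \<bar>\<phi> t - m\<bar>)"
    unfolding Msq using uv by simp
  have "?I (\<lambda>t. \<sigma> * (exp (\<phi> t) - exp m)) \<le> ?I (\<lambda>t. exp M * \<bar>\<phi> t - m\<bar>)"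
  proof (rule integral_le)
    show "(\<lambda>t. \<sigma> * (exp (\<phi> t) - exp m)) integrable_on {u..v}" by (intro integrable_on_mult_right ei')
    show "(\<lambda>t. exp M * \<bar>\<phi> t - m\<bar>) integrable_on {u..v}" by (intro integrable_on_mult_right i)
    fix t assume "t \<in> {u..v}"
    with M[OF this] Mm have "\<bar>exp (\<phi> t) - exp m\<bar> \<le> exp M * \<bar>\<phi> t - m\<bar>"
      by (intro exp_lipschitz) auto
    then show "\<sigma> * (exp (\<phi> t) - exp m) \<le> exp M * \<bar>\<phi> t - m\<bar>" using \<sigma>(1) by auto
  qed
  moreover have "?I (\<lambda>t. \<sigma> * (exp (\<phi> t) - exp m)) = \<sigma> * (?I (\<lambda>t. exp (\<phi> t)) - (v - u) * exp m)"
    using uv Henstock_Kurzweil_Integration.integral_diff[OF set_lebesgue_integral_eq_integral(1)[OF ei] integrable_const_ivl, of "exp m"]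
    by simp
  ultimately have 1: "\<sigma> * ?I (\<lambda>t. exp (\<phi> t)) \<le> (v - u) * (\<sigma> * exp m) + exp M * ?I (\<lambda>t. \<bar>\<phi> t - m\<bar>)"
    by (simp add: algebra_simps)
  have "\<sigma> * exp m \<le> \<sigma> * Bell \<sigma> \<delta> m m2 + exp (M + \<delta>) * (m2 - m\<^sup>2)"
  proof (rule exp_le_Bell[OF \<sigma>])
    show "m\<^sup>2 \<le> m2" unfolding m_def m2_def by (rule mean_power2_le[OF uv int(1,2)])
    have "\<epsilon>\<^sup>2 \<le> \<delta>\<^sup>2" using \<delta> by (intro power_mono) auto
    then show "m2 \<le> m\<^sup>2 + \<delta>\<^sup>2" using int(4)[OF uv] unfolding m_def m2_def by linarith
  qed (use \<delta> Mm in auto)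
  from mult_left_mono[OF this, of "v - u"] uv
  have "(v - u) * (\<sigma> * exp m) \<le> (v - u) * (\<sigma> * Bell \<sigma> \<delta> m m2) + exp (M + \<delta>) * ((v - u) * (m2 - m\<^sup>2))"
    by (simp add: algebra_simps)
  also have "\<dots> \<le> (v - u) * (\<sigma> * Bell \<sigma> \<delta> m m2) + exp (M + \<delta>) * (2 * M * ?I (\<lambda>t. \<bar>\<phi> t - m\<bar>))"
    using var by (intro add_left_mono mult_left_mono) auto
  finally have "(v - u) * (\<sigma> * exp m) \<le> \<dots>" .
  with 1 show ?thesis unfolding m_def[symmetric] m2_def[symmetric] by (simp add: algebra_simps)
qed

text \<open>The ratio \<open>q < 1\<close> depends only on \<epsilon> and \<delta>, so a fixed
  number of generations makes all leaves shorter than a modulus of continuity of \<open>g\<close>;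
  only there is exponential compared with candidate.\<close>

lemma Bellman_induction_bounded:
  fixes \<phi> :: "real \<Rightarrow> real"
  assumes bmo: "bmo_le \<epsilon> a b \<phi>" and ab: "a < b" and \<delta>: "0 \<le> \<epsilon>" "\<epsilon> < \<delta>"
    and \<sigma>: "\<sigma> = 1 \<or> \<sigma> = -1" "\<sigma> * \<delta> < 1"
    and M: "\<And>t. t \<in> {a..b} \<Longrightarrow> \<bar>\<phi> t\<bar> \<le> M"
  shows "\<sigma> * mean a b (\<lambda>t. exp (\<phi> t)) \<le> \<sigma> * Bell \<sigma> \<delta> (mean a b \<phi>) (mean a b (\<lambda>t. (\<phi> t)\<^sup>2))"
proof -
  define G where "G u v = (v - u) * (\<sigma> * Bell \<sigma> \<delta> (mean u v \<phi>) (mean u v (\<lambda>t. (\<phi> t)\<^sup>2)))" for u v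
  define C where "C = exp M + exp (M + \<delta>) * (2 * M)"
  define q where "q = max (1/2) (1 - sqrt (\<delta>\<^sup>2 - \<epsilon>\<^sup>2) / \<delta>)"
  have \<sigma>2: "\<sigma>\<^sup>2 = 1" using \<sigma>(1) by auto
  have "0 \<le> M" using M[of a] ab by auto
  then have C: "C > 0" unfolding C_def by (intro add_pos_nonneg) auto
  have "\<epsilon>\<^sup>2 < \<delta>\<^sup>2" using \<delta> by (intro power_strict_mono) auto
  then have q: "0 < q" "q < 1" using \<delta> by (auto simp: q_def)
  note absint = bmo_leD(3)[OF bmo]
  have ei: "(\<lambda>t. exp (\<phi> t)) integrable_on {a..b}"
  proof (rule set_lebesgue_integral_eq_integral(1)[OF integrable_bounded_compose[OF absint[OF order.refl order.refl]]])
    show "\<bar>exp (\<phi> t)\<bar> \<le> exp M" if "t \<in> {a..b}" for t using M[OF that] by auto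
  qed auto
  have "\<sigma> * integral {a..b} (\<lambda>t. exp (\<phi> t)) \<le> G a b + e" if "e > 0" for e
  proof -
    \<comment> \<open>Chosen, like the distance \<open>e / (4 * C)\<close> to \<open>g\<close>, so
      that each of the two contributions to \<open>E a b\<close> is at most
      \<open>e / 2\<close>.\<close>
    define \<kappa> where "\<kappa> = e / (4 * C * (b - a))"
    have "\<kappa> > 0" "e / (4 * C) > 0" using \<open>e > 0\<close> C ab by (auto simp: \<kappa>_def)
    obtain g where g: "continuous_on {a..b} g" and gi: "(\<lambda>t. \<bar>\<phi> t - g t\<bar>) integrable_on {a..b}"
      and ge: "integral {a..b} (\<lambda>t. \<bar>\<phi> t - g t\<bar>) < e / (4 * C)"
      using L1_approx_continuous[OF absint[OF order.refl order.refl] M \<open>e / (4 * C) > 0\<close>] by blast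
    have "uniformly_continuous_on {a..b} g" using g by (intro compact_uniformly_continuous) auto
    with \<open>\<kappa> > 0\<close> obtain r where "r > 0"
      and r: "\<And>s t. s \<in> {a..b} \<Longrightarrow> t \<in> {a..b} \<Longrightarrow> \<bar>t - s\<bar> < r \<Longrightarrow> \<bar>g t - g s\<bar> < \<kappa>"
      unfolding uniformly_continuous_on_def dist_real_def by metis
    define E where "E u v = C * (2 * integral {u..v} (\<lambda>t. \<bar>\<phi> t - g t\<bar>) + 2 * \<kappa> * (v - u))" for u v
    \<comment> \<open>the error \<open>E\<close> is additive in the interval, so it survives the summation over the leaves\<close>
    have claim: "\<sigma> * integral {u..v} (\<lambda>t. exp (\<phi> t)) \<le> G u v + E u v"
      if "a \<le> u" "u < v" "v \<le> b" "(v - u) * q ^ n < r" for u v n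
      using that
    proof (induction n arbitrary: u v)
      case 0
      note b = bmo_le_subinterval[OF bmo 0(1) 0(3)]
      have "\<sigma> * integral {u..v} (\<lambda>t. exp (\<phi> t)) \<le> G u v + C * integral {u..v} (\<lambda>t. \<bar>\<phi> t - mean u v \<phi>\<bar>)"
        unfolding G_def C_def using 0 \<delta> by (intro Bell_leaf_estimate[OF b 0(2) \<delta>(1) _ \<sigma>] M) auto
      also have "\<dots> \<le> G u v + E u v"
        unfolding E_def
      proof (intro add_left_mono mult_left_mono integral_abs_dev_mean_le)
        show "\<phi> absolutely_integrable_on {u..v}" using absint[OF 0(1,3)] .
        show "(\<lambda>t. \<bar>\<phi> t - g t\<bar>) integrable_on {u..v}"
          using 0 by (intro integrable_on_subinterval[OF gi]) auto
        show "\<bar>g s - g t\<bar> \<le> \<kappa>" if "s \<in> {u..v}" "t \<in> {u..v}" for s t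
          using r[of t s] that 0 by fastforce
      qed (use 0 C in auto)
      finally show ?case .
    next
      case (Suc n)
      note b = bmo_le_subinterval[OF bmo Suc.prems(1,3)]
      obtain c where c: "u < c" "c < v" "c - u \<le> q * (v - u)" "v - c \<le> q * (v - u)"
        and sup: "G u c + G c v \<le> G u v"
        using Bell_superadditive_splitting[OF b Suc.prems(2) \<delta> \<sigma>2 \<sigma>(2)] unfolding G_def q_def by metis
      \<comment> \<open>Each part has at most \<open>q\<close> times the length, so one power of
        \<open>q\<close> fewer suffices for it.\<close>
      have small: "(c - u) * q ^ n < r" "(v - c) * q ^ n < r"
      proof -
        have "q * (v - u) * q ^ n < r" "0 \<le> q ^ n" using Suc.prems(4) q by (simp_all add: mult_ac)
        with mult_right_mono[OF c(3), of "q ^ n"] mult_right_mono[OF c(4), of "q ^ n"]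
        show "(c - u) * q ^ n < r" "(v - c) * q ^ n < r" by linarith+
      qed
      have E: "E u c + E c v = E u v"
      proof -
        have "(\<lambda>t. \<bar>\<phi> t - g t\<bar>) integrable_on {u..v}"
          using Suc.prems by (intro integrable_on_subinterval[OF gi]) auto
        from Henstock_Kurzweil_Integration.integral_combine[OF _ _ this, of c] c
        have "integral {u..v} (\<lambda>t. \<bar>\<phi> t - g t\<bar>) = integral {u..c} (\<lambda>t. \<bar>\<phi> t - g t\<bar>) + integral {c..v} (\<lambda>t. \<bar>\<phi> t - g t\<bar>)"
          by simp
        then show ?thesis unfolding E_def by (simp only:) (simp add: algebra_simps)
      qed
      have "(\<lambda>t. exp (\<phi> t)) integrable_on {u..v}"
        using Suc.prems by (intro integrable_on_subinterval[OF ei]) auto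
      from Henstock_Kurzweil_Integration.integral_combine[OF _ _ this, of c] c
      have "integral {u..v} (\<lambda>t. exp (\<phi> t)) = integral {u..c} (\<lambda>t. exp (\<phi> t)) + integral {c..v} (\<lambda>t. exp (\<phi> t))"
        by simp
      then have "\<sigma> * integral {u..v} (\<lambda>t. exp (\<phi> t))
          = \<sigma> * integral {u..c} (\<lambda>t. exp (\<phi> t)) + \<sigma> * integral {c..v} (\<lambda>t. exp (\<phi> t))"
        by (simp only: distrib_left)
      also have "\<dots> \<le> (G u c + E u c) + (G c v + E c v)"
        using Suc.prems c small by (intro add_mono Suc.IH) auto
      also have "\<dots> \<le> G u v + E u v" using sup E by linarith
      finally show ?case .
    qed
    obtain n where "q ^ n < r / (b - a)" using real_arch_pow_inv[of "r / (b - a)" q] q \<open>r > 0\<close> ab by auto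
    then have "(b - a) * q ^ n < r" using ab by (simp add: field_simps)
    from claim[OF order.refl ab order.refl this]
    have "\<sigma> * integral {a..b} (\<lambda>t. exp (\<phi> t)) \<le> G a b + E a b" .
    also have "E a b \<le> C * (2 * (e / (4 * C)) + 2 * \<kappa> * (b - a))"
      unfolding E_def using ge C by (intro mult_left_mono add_right_mono) auto
    also have "\<dots> = e" unfolding \<kappa>_def using C ab by (simp add: field_simps)
    finally show ?thesis by simp
  qed
  then have "\<sigma> * integral {a..b} (\<lambda>t. exp (\<phi> t)) \<le> G a b" by (rule field_le_epsilon)
  then show ?thesis using ab by (simp add: G_def mean_def field_simps)
qed

section \<open>Removing the boundedness assumption\<close>

definition clamp_real :: "real \<Rightarrow> real \<Rightarrow> real" where
  "clamp_real n x = max (- n) (min n x)"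

lemma clamp_real:
  assumes "0 \<le> n"
  shows "\<bar>clamp_real n x\<bar> \<le> n" "\<bar>clamp_real n x\<bar> \<le> \<bar>x\<bar>" "\<bar>clamp_real n x - clamp_real n y\<bar> \<le> \<bar>x - y\<bar>"
  using assms by (auto simp: clamp_real_def)

lemma borel_measurable_clamp_real [measurable]: "clamp_real n \<in> borel_measurable borel"
  unfolding clamp_real_def[abs_def] by measurable

lemma clamp_real_tendsto: "(\<lambda>n. clamp_real (real n) x) \<longlonglongrightarrow> x"
proof (rule tendsto_eventually)
  obtain N :: nat where "\<bar>x\<bar> \<le> N" using real_arch_simple by blast
  then have "clamp_real (real n) x = x" if "N \<le> n" for n
    using that by (auto simp: clamp_real_def max_def min_def abs_if split: if_splits)
  then show "\<forall>\<^sub>F n in sequentially. clamp_real (real n) x = x"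
    unfolding eventually_sequentially by blast
qed

text \<open>Clamping is 1-Lipschitz, so the squared deviation from the clamped mean is at most that
  of \<phi> from its mean; the variance is smaller still.\<close>

lemma bmo_le_clamp_real:
  assumes bmo: "bmo_le \<epsilon> a b \<phi>" and "0 \<le> n"
  shows "bmo_le \<epsilon> a b (\<lambda>t. clamp_real n (\<phi> t))"
  unfolding bmo_le_def
proof (intro conjI allI impI)
  note absint = bmo_leD(3)[OF bmo order.refl order.refl]
  let ?\<psi> = "\<lambda>t. clamp_real n (\<phi> t)"
  show \<psi>: "?\<psi> absolutely_integrable_on {a..b}"
    by (rule integrable_bounded_compose[OF absint _ clamp_real(1)[OF \<open>0 \<le> n\<close>]]) measurable
  have "(\<lambda>t. (?\<psi> t)\<^sup>2) absolutely_integrable_on {a..b}"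
  proof (rule integrable_bounded_compose[OF absint, where h = "\<lambda>x. (clamp_real n x)\<^sup>2"])
    show "\<bar>(?\<psi> t)\<^sup>2\<bar> \<le> n\<^sup>2" for t
      using power_mono[OF clamp_real(1)[OF \<open>0 \<le> n\<close>, of "\<phi> t"], of 2] by simp
  qed measurable
  then show \<psi>2: "(\<lambda>t. (?\<psi> t)\<^sup>2) integrable_on {a..b}"
    by (rule set_lebesgue_integral_eq_integral)
  fix u v assume uv: "a \<le> u" "u < v" "v \<le> b"
  define m where "m = mean u v \<phi>"
  note int = bmo_leD[OF bmo uv(1,3)]
  have i: "?\<psi> integrable_on {u..v}" "(\<lambda>t. (?\<psi> t)\<^sup>2) integrable_on {u..v}"
    using uv by (auto intro: integrable_on_subinterval[OF \<psi>2]
        integrable_on_subinterval[OF set_lebesgue_integral_eq_integral(1)[OF \<psi>]])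
  have "mean u v (\<lambda>t. (?\<psi> t)\<^sup>2) - (mean u v ?\<psi>)\<^sup>2 \<le> mean u v (\<lambda>t. (?\<psi> t - clamp_real n m)\<^sup>2)"
    by (rule variance_le_mean_sq_dev[OF uv(2) i])
  also have "\<dots> \<le> mean u v (\<lambda>t. (\<phi> t - m)\<^sup>2)"
    unfolding mean_def
  proof (intro divide_right_mono integral_le integral_sq_dev(1) uv i int)
    show "(?\<psi> t - clamp_real n m)\<^sup>2 \<le> (\<phi> t - m)\<^sup>2" for t
      using clamp_real(3)[OF \<open>0 \<le> n\<close>] by (simp add: abs_le_square_iff)
  qed (use uv in auto)
  also have "\<dots> \<le> \<epsilon>\<^sup>2"
    using int(4)[OF uv(2)] unfolding m_def variance_eq_mean_sq_dev[OF uv(2) int(1,2)] .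
  finally show "mean u v (\<lambda>t. (?\<psi> t)\<^sup>2) - (mean u v ?\<psi>)\<^sup>2 \<le> \<epsilon>\<^sup>2" .
qed

lemma mean_clamp_real_tendsto:
  assumes bmo: "bmo_le \<epsilon> a b \<phi>"
  shows "(\<lambda>n. mean a b (\<lambda>t. clamp_real (real n) (\<phi> t))) \<longlonglongrightarrow> mean a b \<phi>"
    "(\<lambda>n. mean a b (\<lambda>t. (clamp_real (real n) (\<phi> t))\<^sup>2)) \<longlonglongrightarrow> mean a b (\<lambda>t. (\<phi> t)\<^sup>2)"
proof -
  note int = bmo_leD[OF bmo order.refl order.refl]
  note cint = bmo_leD[OF bmo_le_clamp_real[OF bmo of_nat_0_le_iff] order.refl order.refl]
  show "(\<lambda>n. mean a b (\<lambda>t. clamp_real (real n) (\<phi> t))) \<longlonglongrightarrow> mean a b \<phi>"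
    unfolding mean_def divide_inverse
  proof (intro tendsto_mult_right dominated_convergence(2) cint(1))
    show "(\<lambda>t. \<bar>\<phi> t\<bar>) integrable_on {a..b}"
      using int(3) by (simp add: absolutely_integrable_on_def)
  qed (auto simp: clamp_real intro: clamp_real_tendsto)
  show "(\<lambda>n. mean a b (\<lambda>t. (clamp_real (real n) (\<phi> t))\<^sup>2)) \<longlonglongrightarrow> mean a b (\<lambda>t. (\<phi> t)\<^sup>2)"
    unfolding mean_def divide_inverse
  proof (intro tendsto_mult_right dominated_convergence(2)[OF cint(2) int(2)])
    show "norm ((clamp_real (real n) (\<phi> t))\<^sup>2) \<le> (\<phi> t)\<^sup>2" for n t
      using clamp_real(2)[of "real n" "\<phi> t"] by (simp add: abs_le_square_iff)
  qed (intro tendsto_intros clamp_real_tendsto)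
qed

section \<open>Limits of truncations in nonnegative integrals\<close>

lemma set_nn_integral_eq_integral:
  fixes f :: "real \<Rightarrow> real"
  assumes "f absolutely_integrable_on {a..b}" "\<And>t. 0 \<le> f t"
  shows "(\<integral>\<^sup>+t\<in>{a..b}. ennreal (f t) \<partial>lebesgue) = ennreal (integral {a..b} f)"
proof -
  have "(\<integral>\<^sup>+t\<in>{a..b}. ennreal (f t) \<partial>lebesgue) = (\<integral>\<^sup>+t. ennreal (indicator {a..b} t * f t) \<partial>lebesgue)"
    by (intro nn_integral_cong) (auto simp: indicator_def)
  also have "\<dots> = ennreal (LINT t|lebesgue. indicator {a..b} t * f t)"
    using assms by (intro nn_integral_eq_integral) (auto simp: set_integrable_def)
  also have "\<dots> = ennreal (integral {a..b} f)"
    using set_lebesgue_integral_eq_integral(2)[OF assms(1)] by (simp add: set_lebesgue_integral_def)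
  finally show ?thesis .
qed

lemma exp_compose_indicator_measurable:
  fixes \<phi> :: "real \<Rightarrow> real" and h :: "real \<Rightarrow> real"
  assumes "\<phi> absolutely_integrable_on {a..b}" "h \<in> borel_measurable borel"
  shows "(\<lambda>t. ennreal (h (\<phi> t)) * indicator {a..b} t) \<in> borel_measurable lebesgue"
proof -
  have "\<phi> \<in> borel_measurable (lebesgue_on {a..b})"
    using assms(1) by (rule absolutely_integrable_imp_borel_measurable) auto
  then have "(\<lambda>t. ennreal (h (\<phi> t))) \<in> borel_measurable (lebesgue_on {a..b})"
    using assms(2) by measurable
  then show ?thesis
    by (subst (asm) borel_measurable_restrict_space_iff_ennreal) auto
qed

lemma Bell_tendsto_args:
  assumes "(f \<longlongrightarrow> x1) F" "(g \<longlongrightarrow> x2) F"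
  shows "((\<lambda>n. Bell \<sigma> \<delta> (f n) (g n)) \<longlongrightarrow> Bell \<sigma> \<delta> x1 x2) F"
  unfolding Bell_def divide_inverse by (intro tendsto_intros assms)

lemma Bell_tendsto_radius:
  assumes "\<sigma> * \<epsilon> < 1"
  shows "((\<lambda>\<delta>. Bell \<sigma> \<delta> x1 x2) \<longlongrightarrow> Bell \<sigma> \<epsilon> x1 x2) (at_right \<epsilon>)"
  unfolding Bell_def using assms by (intro tendsto_intros) auto

lemma exp_clamp_mean:
  assumes bmo: "bmo_le \<epsilon> a b \<phi>" and ab: "a < b" and \<delta>: "0 \<le> \<epsilon>" "\<epsilon> < \<delta>"
    and \<sigma>: "\<sigma> = 1 \<or> \<sigma> = -1" "\<sigma> * \<delta> < 1"
  defines "\<phi>' \<equiv> (\<lambda>n t. clamp_real (real n) (\<phi> t))"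
  shows "\<sigma> * mean a b (\<lambda>t. exp (\<phi>' n t)) \<le> \<sigma> * Bell \<sigma> \<delta> (mean a b (\<phi>' n)) (mean a b (\<lambda>t. (\<phi>' n t)\<^sup>2))"
    and "(\<integral>\<^sup>+t\<in>{a..b}. ennreal (exp (\<phi>' n t)) \<partial>lebesgue) = ennreal ((b - a) * mean a b (\<lambda>t. exp (\<phi>' n t)))"
proof -
  note cb = bmo_le_clamp_real[OF bmo of_nat_0_le_iff]
  show "\<sigma> * mean a b (\<lambda>t. exp (\<phi>' n t)) \<le> \<sigma> * Bell \<sigma> \<delta> (mean a b (\<phi>' n)) (mean a b (\<lambda>t. (\<phi>' n t)\<^sup>2))"
    unfolding \<phi>'_def by (rule Bellman_induction_bounded[OF cb ab \<delta> \<sigma>]) (auto intro: clamp_real)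
  have "(\<lambda>t. exp (\<phi>' n t)) absolutely_integrable_on {a..b}"
    unfolding \<phi>'_def
  proof (rule integrable_bounded_compose[OF bmo_leD(3)[OF cb order.refl order.refl]])
    show "\<bar>exp (clamp_real (real n) (\<phi> t))\<bar> \<le> exp (real n)" for t
      using clamp_real(1)[of "real n" "\<phi> t"] by simp
  qed auto
  from set_nn_integral_eq_integral[OF this] ab
  show "(\<integral>\<^sup>+t\<in>{a..b}. ennreal (exp (\<phi>' n t)) \<partial>lebesgue) = ennreal ((b - a) * mean a b (\<lambda>t. exp (\<phi>' n t)))"
    by (simp add: mean_def)
qed

text \<open>Fatou's lemma along the truncations needs no prior integrability of
  \<open>exp \<circ> \<phi>\<close>; the finite bound delivers it.\<close>

lemma nn_integral_exp_le_Bell: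
  assumes bmo: "bmo_le \<epsilon> a b \<phi>" and ab: "a < b" and \<epsilon>: "0 \<le> \<epsilon>" "\<epsilon> < 1"
  shows "(\<integral>\<^sup>+t\<in>{a..b}. ennreal (exp (\<phi> t)) \<partial>lebesgue)
    \<le> ennreal ((b - a) * Bell 1 \<epsilon> (mean a b \<phi>) (mean a b (\<lambda>t. (\<phi> t)\<^sup>2)))"
proof -
  let ?B = "\<lambda>\<delta>. ennreal ((b - a) * Bell 1 \<delta> (mean a b \<phi>) (mean a b (\<lambda>t. (\<phi> t)\<^sup>2)))"
  let ?\<phi> = "\<lambda>n t. clamp_real (real n) (\<phi> t)"
  note absint = bmo_leD(3)[OF bmo order.refl order.refl]
  have "(\<integral>\<^sup>+t\<in>{a..b}. ennreal (exp (\<phi> t)) \<partial>lebesgue) \<le> ?B \<delta>" if \<delta>: "\<epsilon> < \<delta>" "\<delta> < 1" for \<delta>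
  proof -
    have "(\<integral>\<^sup>+t\<in>{a..b}. ennreal (exp (\<phi> t)) \<partial>lebesgue)
        = (\<integral>\<^sup>+t. liminf (\<lambda>n. ennreal (exp (?\<phi> n t)) * indicator {a..b} t) \<partial>lebesgue)"
    proof (intro nn_integral_cong)
      fix t
      have "(\<lambda>n. ennreal (exp (?\<phi> n t)) * indicator {a..b} t) \<longlonglongrightarrow> ennreal (exp (\<phi> t)) * indicator {a..b} t"
        by (cases "t \<in> {a..b}") (auto intro!: tendsto_ennrealI tendsto_exp clamp_real_tendsto)
      from lim_imp_Liminf[OF _ this]
      show "ennreal (exp (\<phi> t)) * indicator {a..b} t = liminf (\<lambda>n. ennreal (exp (?\<phi> n t)) * indicator {a..b} t)"
        by simp
    qed
    also have "\<dots> \<le> liminf (\<lambda>n. \<integral>\<^sup>+t\<in>{a..b}. ennreal (exp (?\<phi> n t)) \<partial>lebesgue)"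
      by (intro nn_integral_liminf exp_compose_indicator_measurable[OF absint, of "\<lambda>x. exp (clamp_real _ x)"]) measurable
    also have "\<dots> \<le> liminf (\<lambda>n. ennreal ((b - a) * Bell 1 \<delta> (mean a b (?\<phi> n)) (mean a b (\<lambda>t. (?\<phi> n t)\<^sup>2))))"
      using exp_clamp_mean[OF bmo ab \<epsilon>(1) \<delta>(1), of 1] \<delta>(2) ab
      by (intro Liminf_mono always_eventually allI) (auto intro!: ennreal_leI)
    also have "\<dots> = ?B \<delta>"
      by (intro lim_imp_Liminf tendsto_ennrealI tendsto_mult_left Bell_tendsto_args mean_clamp_real_tendsto[OF bmo]) simp
    finally show ?thesis .
  qed
  then have "\<forall>\<^sub>F \<delta> in at_right \<epsilon>. (\<integral>\<^sup>+t\<in>{a..b}. ennreal (exp (\<phi> t)) \<partial>lebesgue) \<le> ?B \<delta>"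
    using \<epsilon>(2) eventually_at_right[of \<epsilon> 1] by blast
  moreover have "(?B \<longlongrightarrow> ?B \<epsilon>) (at_right \<epsilon>)"
    using \<epsilon> by (intro tendsto_ennrealI tendsto_mult_left Bell_tendsto_radius) simp
  ultimately show ?thesis by (intro tendsto_lowerbound) auto
qed

text \<open>Here Fatou's lemma points the wrong way, and the integral may be infinite. A pointwise
  comparison of the truncated exponential with the original one is used instead.\<close>

lemma Bell_le_nn_integral_exp:
  assumes bmo: "bmo_le \<epsilon> a b \<phi>" and ab: "a < b" and \<epsilon>: "0 \<le> \<epsilon>"
  shows "ennreal ((b - a) * Bell (-1) \<epsilon> (mean a b \<phi>) (mean a b (\<lambda>t. (\<phi> t)\<^sup>2)))
    \<le> (\<integral>\<^sup>+t\<in>{a..b}. ennreal (exp (\<phi> t)) \<partial>lebesgue)"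
proof -
  let ?B = "\<lambda>\<delta>. ennreal ((b - a) * Bell (-1) \<delta> (mean a b \<phi>) (mean a b (\<lambda>t. (\<phi> t)\<^sup>2)))"
  let ?\<phi> = "\<lambda>n t. clamp_real (real n) (\<phi> t)"
  let ?X = "\<integral>\<^sup>+t\<in>{a..b}. ennreal (exp (\<phi> t)) \<partial>lebesgue"
  note absint = bmo_leD(3)[OF bmo order.refl order.refl]
  have "?B \<delta> \<le> ?X" if \<delta>: "\<epsilon> < \<delta>" for \<delta>
  proof -
    have le: "ennreal ((b - a) * Bell (-1) \<delta> (mean a b (?\<phi> n)) (mean a b (\<lambda>t. (?\<phi> n t)\<^sup>2)))
        \<le> ?X + ennreal (exp (- real n) * (b - a))" for n
    proof -
      have "ennreal ((b - a) * Bell (-1) \<delta> (mean a b (?\<phi> n)) (mean a b (\<lambda>t. (?\<phi> n t)\<^sup>2)))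
         \<le> (\<integral>\<^sup>+t\<in>{a..b}. ennreal (exp (?\<phi> n t)) \<partial>lebesgue)"
        using exp_clamp_mean[OF bmo ab \<epsilon> \<delta>, of "-1" n] \<epsilon> \<delta> ab by (auto intro!: ennreal_leI)
      also have "\<dots> \<le> (\<integral>\<^sup>+t. (ennreal (exp (\<phi> t)) * indicator {a..b} t + ennreal (exp (- real n)) * indicator {a..b} t) \<partial>lebesgue)"
      proof (intro nn_integral_mono)
        fix t
        \<comment> \<open>Truncation raises \<phi> only where it is below \<open>- n\<close>, and
          there the truncated exponential is \<open>exp (- n)\<close>.\<close>
        have "exp (?\<phi> n t) \<le> exp (\<phi> t) + exp (- real n)"
          by (auto simp: clamp_real_def max_def min_def intro: add_increasing add_increasing2)
        then have "ennreal (exp (?\<phi> n t)) \<le> ennreal (exp (\<phi> t)) + ennreal (exp (- real n))"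
          by (simp flip: ennreal_plus)
        then show "ennreal (exp (?\<phi> n t)) * indicator {a..b} t
           \<le> ennreal (exp (\<phi> t)) * indicator {a..b} t + ennreal (exp (- real n)) * indicator {a..b} t"
          by (auto simp: indicator_def)
      qed
      also have "\<dots> = ?X + (\<integral>\<^sup>+t\<in>{a..b}. ennreal (exp (- real n)) \<partial>lebesgue)"
        by (intro nn_integral_add exp_compose_indicator_measurable[OF absint]) auto
      also have "(\<integral>\<^sup>+t\<in>{a..b}. ennreal (exp (- real n)) \<partial>lebesgue) = ennreal (exp (- real n) * (b - a))"
        using ab by (simp add: nn_integral_cmult_indicator ennreal_mult')
      finally show ?thesis .
    qed
    show ?thesis
    proof (rule tendsto_le)
      show "(\<lambda>n. ennreal ((b - a) * Bell (-1) \<delta> (mean a b (?\<phi> n)) (mean a b (\<lambda>t. (?\<phi> n t)\<^sup>2)))) \<longlonglongrightarrow> ?B \<delta>"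
        by (intro tendsto_ennrealI tendsto_mult_left Bell_tendsto_args mean_clamp_real_tendsto[OF bmo])
      have "(\<lambda>n. exp (- real n) * (b - a)) \<longlonglongrightarrow> 0 * (b - a)"
        by (intro tendsto_mult_right filterlim_compose[OF exp_at_bot])
           (simp add: filterlim_uminus_at_bot filterlim_real_sequentially)
      then have "(\<lambda>n. ?X + ennreal (exp (- real n) * (b - a))) \<longlonglongrightarrow> ?X + ennreal (0 * (b - a))"
        by (intro tendsto_add tendsto_const tendsto_ennrealI)
      then show "(\<lambda>n. ?X + ennreal (exp (- real n) * (b - a))) \<longlonglongrightarrow> ?X" by simp
    qed (use le in auto)
  qed
  then have "\<forall>\<^sub>F \<delta> in at_right \<epsilon>. ?B \<delta> \<le> ?X"
    using eventually_at_right_less[of \<epsilon>] by (auto elim: eventually_mono)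
  moreover have "(?B \<longlongrightarrow> ?B \<epsilon>) (at_right \<epsilon>)"
    using \<epsilon> by (intro tendsto_ennrealI tendsto_mult_left Bell_tendsto_radius) simp
  ultimately show ?thesis by (intro tendsto_upperbound) auto
qed

section \<open>From intervals with or without endpoints to closed intervals\<close>

lemma bdd_interval_bounds:
  assumes "bdd_interval J"
  obtains a b where "a < b" "{a<..<b} \<subseteq> J" "J \<subseteq> {a..b}"
proof -
  have J: "is_interval J" "bounded J" "interior J \<noteq> {}" using assms by (auto simp: bdd_interval_def)
  then obtain x where "x \<in> interior J" by auto
  then obtain e where e: "e > 0" "cball x e \<subseteq> J" unfolding mem_interior_cball by auto
  then have xe: "x - e \<in> J" "x + e \<in> J" by (auto simp: dist_real_def)
  have bdd: "bdd_above J" "bdd_below J" using J(2) by (auto intro: bounded_imp_bdd_above bounded_imp_bdd_below)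
  have "Inf J \<le> x - e" "x + e \<le> Sup J" using xe bdd by (auto intro: cInf_lower cSup_upper)
  show thesis
  proof (rule that[of "Inf J" "Sup J"])
    show "Inf J < Sup J" using \<open>Inf J \<le> x - e\<close> \<open>x + e \<le> Sup J\<close> e(1) by linarith
    show "J \<subseteq> {Inf J..Sup J}" using bdd by (auto intro: cInf_lower cSup_upper)
    show "{Inf J<..<Sup J} \<subseteq> J"
    proof
      fix t assume "t \<in> {Inf J<..<Sup J}"
      then obtain y z where "y \<in> J" "y < t" "z \<in> J" "t < z"
        using xe cInf_lessD[of J t] less_cSupD[of J t] by auto
      with J(1) show "t \<in> J" unfolding is_interval_1 by (meson less_imp_le)
    qed
  qed
qed

context
  fixes J :: "real set" and a b :: real
  assumes ab: "a < b" and J: "{a<..<b} \<subseteq> J" "J \<subseteq> {a..b}"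
begin

lemma bdd_intervalI: "bdd_interval J"
  unfolding bdd_interval_def
proof (intro conjI)
  show "is_interval J"
    unfolding is_interval_1
  proof safe
    fix x y t assume "x \<in> J" "y \<in> J" "x \<le> t" "t \<le> y"
    moreover have "t \<in> J" if "x < t" "t < y"
    proof -
      have "a \<le> x" "y \<le> b" using J \<open>x \<in> J\<close> \<open>y \<in> J\<close> by auto
      with that J(1) show ?thesis by auto
    qed
    ultimately show "t \<in> J" by (cases "x = t"; cases "t = y") auto
  qed
  show "bounded J" using bounded_subset[OF _ J(2)] by simp
  have "{a<..<b} \<subseteq> interior J" using J(1) by (intro interior_maximal) auto
  then show "interior J \<noteq> {}" using ab by fastforce
qed

lemma interval_symdiff_negligible: "negligible (J - {a..b} \<union> ({a..b} - J))"
proof (rule negligible_subset[of "{a, b}"])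
  show "J - {a..b} \<union> ({a..b} - J) \<subseteq> {a, b}"
  proof
    fix t assume "t \<in> J - {a..b} \<union> ({a..b} - J)"
    then have "t \<in> {a..b} - {a<..<b}" using J by blast
    then show "t \<in> {a, b}" by auto
  qed
qed simp

lemma interval_AE_indicator: "AE t in lebesgue. indicator J t = (indicator {a..b} t :: 'c::zero_neq_one)"
proof (rule AE_I')
  show "{a, b} \<in> null_sets lebesgue"
    using negligible_finite[of "{a, b}"] by (simp add: negligible_iff_null_sets)
  show "{t \<in> space lebesgue. indicator J t \<noteq> (indicator {a..b} t :: 'c)} \<subseteq> {a, b}"
  proof
    fix t assume "t \<in> {t \<in> space lebesgue. indicator J t \<noteq> (indicator {a..b} t :: 'c)}"
    then have "(t \<in> J) \<noteq> (t \<in> {a..b})" by (auto simp: indicator_def split: if_splits)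
    then have "t \<in> {a..b} - {a<..<b}" using J by blast
    then show "t \<in> {a, b}" by auto
  qed
qed

lemma interval_sets_lebesgue: "J \<in> sets lebesgue"
proof -
  have "{a..b} = {a<..<b} \<union> {a, b}" using ab by auto
  then have "J = {a<..<b} \<union> (J \<inter> {a, b})" using J by blast
  moreover have "finite (J \<inter> {a, b})" by simp
  then have "J \<inter> {a, b} \<in> sets lebesgue" by (intro sets_completionI_sets) (auto intro: finite_imp_closed borel_closed)
  ultimately show ?thesis by (metis fmeasurableD lmeasurable_box box_real(1) sets.Un)
qed

lemma interval_emeasure: "emeasure lebesgue J = ennreal (b - a)"
proof -
  have "emeasure lebesgue J = (\<integral>\<^sup>+t. indicator J t \<partial>lebesgue)"
    using interval_sets_lebesgue by simp
  also have "\<dots> = (\<integral>\<^sup>+t. indicator {a..b} t \<partial>lebesgue)"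
    by (rule nn_integral_cong_AE[OF interval_AE_indicator])
  also have "\<dots> = ennreal (b - a)" using ab by simp
  finally show ?thesis .
qed

lemma interval_set_integrable_iff:
  fixes f :: "real \<Rightarrow> real"
  shows "set_integrable lebesgue J f \<longleftrightarrow> f absolutely_integrable_on {a..b}"
proof (rule absolutely_integrable_spike_set_eq)
  show "negligible {x \<in> J - {a..b}. f x \<noteq> 0}" "negligible {x \<in> {a..b} - J. f x \<noteq> 0}"
    by (rule negligible_subset[OF interval_symdiff_negligible]; auto)+
qed

lemma avg_eq_mean:
  assumes "f absolutely_integrable_on {a..b}"
  shows "avg J f = mean a b f"
proof -
  have "(LINT t:J|lebesgue. f t) = integral J f"
    using assms by (intro set_lebesgue_integral_eq_integral) (simp add: interval_set_integrable_iff)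
  also have "\<dots> = integral {a..b} f"
    by (rule integral_spike_set; rule negligible_subset[OF interval_symdiff_negligible]; auto)
  finally show ?thesis using ab by (simp add: avg_def mean_def measure_def interval_emeasure)
qed

lemma nn_avg_eq: "nn_avg J f = (\<integral>\<^sup>+t\<in>{a..b}. ennreal (f t) \<partial>lebesgue) / ennreal (b - a)"
proof -
  have "(\<integral>\<^sup>+t\<in>J. ennreal (f t) \<partial>lebesgue) = (\<integral>\<^sup>+t\<in>{a..b}. ennreal (f t) \<partial>lebesgue)"
  proof (rule nn_integral_cong_AE)
    show "AE t in lebesgue. ennreal (f t) * indicator J t = ennreal (f t) * indicator {a..b} t"
      using interval_AE_indicator[where 'c = ennreal] by eventually_elim simp
  qed
  then show ?thesis by (simp add: nn_avg_def interval_emeasure)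
qed

lemma nn_avg_eq_mean:
  assumes "f absolutely_integrable_on {a..b}" "\<And>t. 0 \<le> f t"
  shows "nn_avg J f = ennreal (mean a b f)"
  using set_nn_integral_eq_integral[OF assms] ab
  by (simp add: nn_avg_eq mean_def divide_ennreal integral_nonneg assms set_lebesgue_integral_eq_integral(1))

lemma nn_avg_finite_imp_integrable:
  fixes \<phi> :: "real \<Rightarrow> real"
  assumes "\<phi> absolutely_integrable_on {a..b}" "nn_avg J (\<lambda>t. (\<phi> t)\<^sup>2) < \<infinity>"
  shows "(\<lambda>t. (\<phi> t)\<^sup>2) absolutely_integrable_on {a..b}"
  unfolding set_integrable_def
proof (rule integrableI_bounded)
  have "(\<lambda>t. indicat_real {a..b} t * \<phi> t) \<in> borel_measurable lebesgue"
    using assms(1) by (auto simp: set_integrable_def)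
  then have "(\<lambda>t. (indicat_real {a..b} t * \<phi> t)\<^sup>2) \<in> borel_measurable lebesgue" by measurable
  moreover have "(\<lambda>t. (indicat_real {a..b} t * \<phi> t)\<^sup>2) = (\<lambda>t. indicator {a..b} t *\<^sub>R (\<phi> t)\<^sup>2)"
    by (auto simp: indicator_def)
  ultimately show "(\<lambda>t. indicator {a..b} t *\<^sub>R (\<phi> t)\<^sup>2) \<in> borel_measurable lebesgue" by simp
  have "(\<integral>\<^sup>+t\<in>{a..b}. ennreal ((\<phi> t)\<^sup>2) \<partial>lebesgue) < \<infinity>"
    using assms(2) ab unfolding nn_avg_eq by (auto simp: ennreal_divide_eq_top_iff less_top[symmetric])
  moreover have "(\<integral>\<^sup>+t\<in>{a..b}. ennreal ((\<phi> t)\<^sup>2) \<partial>lebesgue) = (\<integral>\<^sup>+t. ennreal (norm (indicator {a..b} t *\<^sub>R (\<phi> t)\<^sup>2)) \<partial>lebesgue)"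
    by (intro nn_integral_cong) (auto simp: indicator_def)
  ultimately show "(\<integral>\<^sup>+t. ennreal (norm (indicator {a..b} t *\<^sub>R (\<phi> t)\<^sup>2)) \<partial>lebesgue) < \<infinity>" by simp
qed

end

text \<open>A square that is not integrable has \<open>nn_avg\<close> equal to \<infinity>, so a
  finite supremum already forces square integrability on the whole interval. Endpoints do not affect
  averages, which makes all kinds of subintervals equivalent.\<close>

lemma BMO_ball_iff_bmo_le:
  assumes ab: "a < b" and I: "{a<..<b} \<subseteq> I" "I \<subseteq> {a..b}" and "0 \<le> \<epsilon>"
  shows "\<phi> \<in> BMO_ball \<epsilon> I \<longleftrightarrow> bmo_le \<epsilon> a b \<phi>"
proof
  assume "\<phi> \<in> BMO_ball \<epsilon> I"
  then have int: "\<phi> absolutely_integrable_on {a..b}" and fin: "bmo_sup I \<phi> < \<infinity>"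
    and norm: "sqrt (real_of_ereal (bmo_sup I \<phi>)) \<le> \<epsilon>"
    by (auto simp: BMO_ball_def BMO_def bmo_norm_def interval_set_integrable_iff[OF ab I])
  have "real_of_ereal (bmo_sup I \<phi>) \<le> \<epsilon>\<^sup>2"
    using norm by (rule sqrt_le_D)
  \<comment> \<open>\<open>fin\<close> excludes the value \<infinity>, which
    \<open>real_of_ereal\<close> would send to 0.\<close>
  then have sup: "bmo_sup I \<phi> \<le> ereal (\<epsilon>\<^sup>2)" using fin by (cases "bmo_sup I \<phi>") auto
  have le: "enn2ereal (nn_avg {u<..<v} (\<lambda>t. (\<phi> t)\<^sup>2)) - ereal ((mean u v \<phi>)\<^sup>2) \<le> ereal (\<epsilon>\<^sup>2)"
    and uvint: "\<phi> absolutely_integrable_on {u..v}" if "a \<le> u" "u < v" "v \<le> b" for u v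
  proof -
    show uv: "\<phi> absolutely_integrable_on {u..v}"
      using that by (intro absolutely_integrable_on_subinterval[OF int]) auto
    \<comment> \<open>Open subintervals are tested, since \<open>{u..v}\<close> need not lie in
      \<open>I\<close> when an endpoint of \<open>I\<close> is missing.\<close>
    have "bdd_interval {u<..<v}" by (rule bdd_intervalI[OF that(2)]) auto
    moreover have "{u<..<v} \<subseteq> {a<..<b}" using that by auto
    then have "{u<..<v} \<subseteq> I" using I(1) by (rule order.trans)
    ultimately have "enn2ereal (nn_avg {u<..<v} (\<lambda>t. (\<phi> t)\<^sup>2)) - ereal ((avg {u<..<v} \<phi>)\<^sup>2) \<le> bmo_sup I \<phi>"
      unfolding bmo_sup_def by (intro SUP_upper) auto
    also have "avg {u<..<v} \<phi> = mean u v \<phi>"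
      by (rule avg_eq_mean[OF that(2) _ _ uv]) auto
    finally show "enn2ereal (nn_avg {u<..<v} (\<lambda>t. (\<phi> t)\<^sup>2)) - ereal ((mean u v \<phi>)\<^sup>2) \<le> ereal (\<epsilon>\<^sup>2)"
      using sup by (rule order.trans)
  qed
  have sqint: "(\<lambda>t. (\<phi> t)\<^sup>2) absolutely_integrable_on {a..b}"
  proof (rule nn_avg_finite_imp_integrable[OF ab _ _ int, of "{a<..<b}"])
    show "nn_avg {a<..<b} (\<lambda>t. (\<phi> t)\<^sup>2) < \<infinity>"
      using le[OF order.refl ab order.refl] by (cases "nn_avg {a<..<b} (\<lambda>t. (\<phi> t)\<^sup>2)") auto
  qed auto
  show "bmo_le \<epsilon> a b \<phi>"
    unfolding bmo_le_def
  proof (intro conjI allI impI int set_lebesgue_integral_eq_integral(1)[OF sqint])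
    fix u v assume uv: "a \<le> u" "u < v" "v \<le> b"
    have sq: "(\<lambda>t. (\<phi> t)\<^sup>2) absolutely_integrable_on {u..v}"
      using uv by (intro absolutely_integrable_on_subinterval[OF sqint]) auto
    have "nn_avg {u<..<v} (\<lambda>t. (\<phi> t)\<^sup>2) = ennreal (mean u v (\<lambda>t. (\<phi> t)\<^sup>2))"
      by (rule nn_avg_eq_mean[OF uv(2) _ _ sq]) auto
    moreover have "0 \<le> mean u v (\<lambda>t. (\<phi> t)\<^sup>2)"
      using uv by (simp add: mean_def integral_nonneg set_lebesgue_integral_eq_integral(1)[OF sq])
    ultimately show "mean u v (\<lambda>t. (\<phi> t)\<^sup>2) - (mean u v \<phi>)\<^sup>2 \<le> \<epsilon>\<^sup>2"
      using le[OF uv] by (simp add: enn2ereal_ennreal)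
  qed
next
  assume bmo: "bmo_le \<epsilon> a b \<phi>"
  have sup: "bmo_sup I \<phi> \<le> ereal (\<epsilon>\<^sup>2)"
    unfolding bmo_sup_def
  proof (rule SUP_least)
    fix J assume "J \<in> {J. bdd_interval J \<and> J \<subseteq> I}"
    then have J: "bdd_interval J" "J \<subseteq> I" by auto
    from bdd_interval_bounds[OF J(1)] obtain u v where uv: "u < v" "{u<..<v} \<subseteq> J" "J \<subseteq> {u..v}" by blast
    have "{u<..<v} \<subseteq> {a..b}" using uv J I by blast
    then have ord: "a \<le> u" "v \<le> b" using uv(1) by (auto simp: greaterThanLessThan_subseteq_atLeastAtMost_iff)
    note int = bmo_leD[OF bmo ord]
    have sq: "(\<lambda>t. (\<phi> t)\<^sup>2) absolutely_integrable_on {u..v}"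
      using int(2) by (intro nonnegative_absolutely_integrable_1) auto
    have "0 \<le> mean u v (\<lambda>t. (\<phi> t)\<^sup>2)"
      using uv by (simp add: mean_def integral_nonneg int)
    then show "enn2ereal (nn_avg J (\<lambda>t. (\<phi> t)\<^sup>2)) - ereal ((avg J \<phi>)\<^sup>2) \<le> ereal (\<epsilon>\<^sup>2)"
      using int(4)[OF uv(1)] avg_eq_mean[OF uv int(3)] nn_avg_eq_mean[OF uv sq]
      by (simp add: enn2ereal_ennreal)
  qed
  then have "real_of_ereal (bmo_sup I \<phi>) \<le> \<epsilon>\<^sup>2" by (cases "bmo_sup I \<phi>") auto
  then have "bmo_norm I \<phi> \<le> \<epsilon>"
    unfolding bmo_norm_def using \<open>0 \<le> \<epsilon>\<close> by (intro real_le_lsqrt)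
  moreover have "bmo_sup I \<phi> < \<infinity>" using sup by auto
  ultimately show "\<phi> \<in> BMO_ball \<epsilon> I"
    using bmo_leD(3)[OF bmo order.refl order.refl]
    by (simp add: BMO_ball_def BMO_def interval_set_integrable_iff[OF ab I])
qed

lemma test_functions_iff:
  assumes ab: "a < b" and I: "{a<..<b} \<subseteq> I" "I \<subseteq> {a..b}" and "0 \<le> \<epsilon>"
  shows "\<phi> \<in> test_functions I \<epsilon> (x1, x2) \<longleftrightarrow>
    bmo_le \<epsilon> a b \<phi> \<and> mean a b \<phi> = x1 \<and> mean a b (\<lambda>t. (\<phi> t)\<^sup>2) = x2"
proof -
  have "avg I \<phi> = mean a b \<phi>" "avg I (\<lambda>t. (\<phi> t)\<^sup>2) = mean a b (\<lambda>t. (\<phi> t)\<^sup>2)" if bmo: "bmo_le \<epsilon> a b \<phi>"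
    using bmo_leD[OF bmo order.refl order.refl]
    by (auto intro!: avg_eq_mean[OF ab I] nonnegative_absolutely_integrable_1)
  then show ?thesis
    unfolding test_functions_def by (auto simp: BMO_ball_iff_bmo_le[OF assms])
qed

section \<open>Cut-off logarithms\<close>

text \<open>The integrands below are singular at \<open>a\<close>. The fundamental theorem asks for
  the derivative only in the interior, and \<open>G0\<close> supplies continuity of the primitive at
  the singular end. The primitives used carry a factor \<open>y\<close>, so their value at 0 is 0
  whatever the default of the logarithm.\<close>

lemma has_integral_shifted_singular:
  fixes G g :: "real \<Rightarrow> real"
  assumes G: "\<And>y. 0 < y \<Longrightarrow> (G has_real_derivative g y) (at y)" and G0: "(G \<longlongrightarrow> G 0) (at_right 0)"
    and "a \<le> u" "u \<le> v"
  shows "((\<lambda>t. g (t - a)) has_integral G (v - a) - G (u - a)) {u..v}"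
proof (rule fundamental_theorem_of_calculus_interior[OF \<open>u \<le> v\<close>])
  have "continuous_on {0..} G"
    unfolding continuous_on_def
  proof
    fix y :: real assume "y \<in> {0..}"
    show "(G \<longlongrightarrow> G y) (at y within {0..})"
    proof (cases "y = 0")
      case True
      then show ?thesis using G0 by (simp add: at_within_Ici_at_right)
    next
      case False
      with \<open>y \<in> {0..}\<close> have "isCont G y" using DERIV_isCont[OF G[of y]] by simp
      then show ?thesis unfolding isCont_def by (rule tendsto_within_subset) simp
    qed
  qed
  then show "continuous_on {u..v} (\<lambda>t. G (t - a))"
    by (rule continuous_on_compose2) (use \<open>a \<le> u\<close> in \<open>auto intro!: continuous_intros\<close>)
  fix t assume "t \<in> {u<..<v}"
  then have "0 < t - a" using \<open>a \<le> u\<close> by auto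
  have "((\<lambda>t. t - a) has_real_derivative 1) (at t)" by (auto intro!: derivative_eq_intros)
  from DERIV_chain2[OF G[OF \<open>0 < t - a\<close>] this]
  show "((\<lambda>t. G (t - a)) has_vector_derivative g (t - a)) (at t)"
    by (simp add: has_real_derivative_iff_has_vector_derivative)
qed

lemma tendsto_mult_ln_0:
  fixes A :: real
  assumes "0 < A"
  shows "((\<lambda>y. y * ln (A / y) + y) \<longlongrightarrow> 0) (at_right 0)"
    "((\<lambda>y. y * ((ln (A / y))\<^sup>2 + 2 * ln (A / y) + 2)) \<longlongrightarrow> 0) (at_right 0)"
    "((\<lambda>y. y * ((ln (y / A))\<^sup>2 + 1)) \<longlongrightarrow> 0) (at_right 0)"
proof -
  show "((\<lambda>y. y * ln (A / y) + y) \<longlongrightarrow> 0) (at_right 0)" using assms by real_asymp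
  show "((\<lambda>y. y * ((ln (A / y))\<^sup>2 + 2 * ln (A / y) + 2)) \<longlongrightarrow> 0) (at_right 0)" using assms by real_asymp
  show "((\<lambda>y. y * ((ln (y / A))\<^sup>2 + 1)) \<longlongrightarrow> 0) (at_right 0)" using assms by real_asymp
qed

text \<open>The normalised moments 1 and 2 give variance 1, whence the coefficient \<epsilon> of the
  extremals. In the third integral the integrand is the power \<kappa> of
  \<open>A / (t - a)\<close>.\<close>

lemma has_integral_ln_singular:
  fixes a A \<kappa> :: real
  assumes "0 < A"
  shows "((\<lambda>t. ln (A / (t - a))) has_integral A) {a..a + A}"
    "((\<lambda>t. (ln (A / (t - a)))\<^sup>2) has_integral 2 * A) {a..a + A}"
    "\<kappa> < 1 \<Longrightarrow> ((\<lambda>t. exp (\<kappa> * ln (A / (t - a)))) has_integral A / (1 - \<kappa>)) {a..a + A}"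
proof -
  have L: "((\<lambda>y::real. ln (A / y)) has_real_derivative - 1 / y) (at y)" if "0 < y" for y
  proof -
    have "((\<lambda>y. A / y) has_real_derivative - A / y\<^sup>2) (at y)"
      using that by (auto intro!: derivative_eq_intros simp: power2_eq_square)
    from DERIV_chain2[OF DERIV_ln_divide this] that assms
    show ?thesis by (simp add: power2_eq_square)
  qed
  have "((\<lambda>t. ln (A / (t - a))) has_integral (\<lambda>y. y * ln (A / y) + y) (a + A - a) - (\<lambda>y. y * ln (A / y) + y) (a - a)) {a..a + A}"
  proof (rule has_integral_shifted_singular)
    show "((\<lambda>y. y * ln (A / y) + y) has_real_derivative ln (A / y)) (at y)" if "0 < y" for y
    proof -
      have "((\<lambda>y. y * ln (A / y) + y) has_real_derivative (1 * ln (A / y) + - 1 / y * y) + 1) (at y)"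
        using that by (intro DERIV_add DERIV_mult DERIV_ident L)
      then show ?thesis using that by simp
    qed
    show "((\<lambda>y. y * ln (A / y) + y) \<longlongrightarrow> 0 * ln (A / 0) + 0) (at_right 0)"
      using tendsto_mult_ln_0(1)[OF assms] by simp
  qed (use assms in auto)
  then show "((\<lambda>t. ln (A / (t - a))) has_integral A) {a..a + A}" using assms by simp
  let ?G = "\<lambda>y. y * ((ln (A / y))\<^sup>2 + 2 * ln (A / y) + 2)"
  have "((\<lambda>t. (ln (A / (t - a)))\<^sup>2) has_integral ?G (a + A - a) - ?G (a - a)) {a..a + A}"
  proof (rule has_integral_shifted_singular)
    show "(?G has_real_derivative (ln (A / y))\<^sup>2) (at y)" if "0 < y" for y
    proof -
      have "((\<lambda>y. (ln (A / y))\<^sup>2) has_real_derivative 2 * ln (A / y) * (- 1 / y)) (at y)"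
        using DERIV_power[OF L[OF that], of 2] by (simp add: mult_ac)
      then have "(?G has_real_derivative 1 * ((ln (A / y))\<^sup>2 + 2 * ln (A / y) + 2)
          + (2 * ln (A / y) * (- 1 / y) + 2 * (- 1 / y) + 0) * y) (at y)"
        using that by (intro DERIV_mult DERIV_add DERIV_cmult DERIV_ident DERIV_const L)
      moreover have "(2 * ln (A / y) * (- 1 / y) + 2 * (- 1 / y) + 0) * y = - 2 * ln (A / y) - 2"
        using that by (simp add: field_simps)
      ultimately show ?thesis by simp
    qed
    show "(?G \<longlongrightarrow> ?G 0) (at_right 0)"
      using tendsto_mult_ln_0(2)[OF assms] by simp
  qed (use assms in auto)
  then show "((\<lambda>t. (ln (A / (t - a)))\<^sup>2) has_integral 2 * A) {a..a + A}" using assms by (simp add: mult.commute)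
  assume \<kappa>: "\<kappa> < 1"
  let ?H = "\<lambda>y. y * exp (\<kappa> * ln (A / y)) / (1 - \<kappa>)"
  have "((\<lambda>t. exp (\<kappa> * ln (A / (t - a)))) has_integral ?H (a + A - a) - ?H (a - a)) {a..a + A}"
  proof (rule has_integral_shifted_singular)
    show "(?H has_real_derivative exp (\<kappa> * ln (A / y))) (at y)" if "0 < y" for y
    proof -
      have "(?H has_real_derivative (1 * exp (\<kappa> * ln (A / y)) + exp (\<kappa> * ln (A / y)) * (\<kappa> * (- 1 / y)) * y) / (1 - \<kappa>)) (at y)"
        using that by (intro DERIV_cdivide DERIV_mult DERIV_fun_exp DERIV_cmult L DERIV_ident)
      moreover have "(1 * exp (\<kappa> * ln (A / y)) + exp (\<kappa> * ln (A / y)) * (\<kappa> * (- 1 / y)) * y) / (1 - \<kappa>) = exp (\<kappa> * ln (A / y))"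
        using that \<kappa> by (simp add: field_simps)
      ultimately show ?thesis by simp
    qed
    \<comment> \<open>The primitive is a multiple of the power \<open>1 - \<kappa>\<close> of
      \<open>y\<close>, which tends to 0 because \<kappa> < 1.\<close>
    have "filterlim (\<lambda>y. (1 - \<kappa>) * ln y) at_bot (at_right 0)"
      using \<kappa> by (intro filterlim_tendsto_pos_mult_at_bot[OF tendsto_const] ln_at_0) auto
    then have "((\<lambda>y. exp (\<kappa> * ln A) * exp ((1 - \<kappa>) * ln y) / (1 - \<kappa>)) \<longlongrightarrow> exp (\<kappa> * ln A) * 0 / (1 - \<kappa>)) (at_right 0)"
      using \<kappa> by (intro tendsto_intros filterlim_compose[OF exp_at_bot]) auto
    moreover have "\<forall>\<^sub>F y in at_right 0. exp (\<kappa> * ln A) * exp ((1 - \<kappa>) * ln y) / (1 - \<kappa>) = ?H y"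
    proof (rule eventually_mono[OF eventually_at_right_less])
      fix y :: real assume "0 < y"
      then have "y * exp (\<kappa> * ln (A / y)) = exp (ln y + \<kappa> * (ln A - ln y))"
        using assms by (simp add: exp_add ln_div)
      also have "ln y + \<kappa> * (ln A - ln y) = \<kappa> * ln A + (1 - \<kappa>) * ln y" by (simp add: algebra_simps)
      finally show "exp (\<kappa> * ln A) * exp ((1 - \<kappa>) * ln y) / (1 - \<kappa>) = ?H y" by (simp add: exp_add)
    qed
    ultimately show "(?H \<longlongrightarrow> ?H 0) (at_right 0)" by (simp add: filterlim_cong)
  qed (use assms in auto)
  then show "((\<lambda>t. exp (\<kappa> * ln (A / (t - a)))) has_integral A / (1 - \<kappa>)) {a..a + A}" using assms by simp
qed

text \<open>The variance of \<open>ln (t - a)\<close> on \<open>{u..v}\<close> is at most \<open>1\<close>: compare with the constant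
  \<open>ln (v - a) - 1\<close>, and use the primitive \<open>y * ((ln y)\<^sup>2 + 1)\<close> of \<open>(1 + ln y)\<^sup>2\<close>.\<close>

lemma integral_ln_dev_le:
  fixes a u v :: real
  assumes "a \<le> u" "u < v"
  shows "(\<lambda>t. (1 + ln ((t - a) / (v - a)))\<^sup>2) integrable_on {u..v}"
    "integral {u..v} (\<lambda>t. (1 + ln ((t - a) / (v - a)))\<^sup>2) \<le> v - u"
proof -
  let ?q = "v - a"
  let ?G = "\<lambda>y. y * ((ln (y / ?q))\<^sup>2 + 1)"
  have q: "0 < ?q" using assms by linarith
  have "((\<lambda>t. (1 + ln ((t - a) / ?q))\<^sup>2) has_integral ?G (v - a) - ?G (u - a)) {u..v}"
  proof (rule has_integral_shifted_singular)
    fix y :: real assume "0 < y"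
    have "((\<lambda>y. y / ?q) has_real_derivative 1 / ?q) (at y)"
      by (intro DERIV_cdivide DERIV_ident)
    from DERIV_chain2[OF DERIV_ln_divide this] \<open>0 < y\<close> q
    have L: "((\<lambda>y. ln (y / ?q)) has_real_derivative 1 / y) (at y)" by simp
    have "((\<lambda>y. (ln (y / ?q))\<^sup>2) has_real_derivative 2 * ln (y / ?q) * (1 / y)) (at y)"
      using DERIV_power[OF L, of 2] by (simp add: mult_ac)
    then have "(?G has_real_derivative 1 * ((ln (y / ?q))\<^sup>2 + 1) + (2 * ln (y / ?q) * (1 / y) + 0) * y) (at y)"
      by (intro DERIV_mult DERIV_add DERIV_ident DERIV_const)
    moreover have "(2 * ln (y / ?q) * (1 / y) + 0) * y = 2 * ln (y / ?q)" using \<open>0 < y\<close> by simp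
    ultimately show "(?G has_real_derivative (1 + ln (y / ?q))\<^sup>2) (at y)"
      by (simp add: power2_sum algebra_simps)
  next
    show "(?G \<longlongrightarrow> ?G 0) (at_right 0)"
      using tendsto_mult_ln_0(3)[OF q] by simp
  qed (use assms in auto)
  \<comment> \<open>The logarithm vanishes at \<open>v - a\<close>; what is dropped is the
    nonnegative \<open>(u - a) * (ln ((u - a) / ?q))\<^sup>2\<close>.\<close>
  moreover have "?G (v - a) - ?G (u - a) \<le> v - u"
    using mult_right_mono[of 0 "u - a" "(ln ((u - a) / ?q))\<^sup>2"] assms by (simp add: algebra_simps)
  ultimately show "(\<lambda>t. (1 + ln ((t - a) / (v - a)))\<^sup>2) integrable_on {u..v}"
    "integral {u..v} (\<lambda>t. (1 + ln ((t - a) / (v - a)))\<^sup>2) \<le> v - u"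
    by (auto simp: has_integral_iff)
qed

text \<open>At \<open>t = a\<close> the value is 0, since division by 0 and \<open>ln 0\<close> both
  default to 0; pointwise bounds therefore treat \<open>a\<close> separately.\<close>

definition log_cutoff :: "real \<Rightarrow> real \<Rightarrow> real \<Rightarrow> real" where
  "log_cutoff a A t = (if t - a < A then ln (A / (t - a)) else 0)"

lemma log_cutoff_nonneg:
  assumes "a \<le> t"
  shows "0 \<le> log_cutoff a A t"
proof (cases "t = a \<or> \<not> t - a < A")
  case False
  with assms have "1 \<le> A / (t - a)" by simp
  then show ?thesis by (simp add: log_cutoff_def)
qed (auto simp: log_cutoff_def)

text \<open>\<open>X\<close> is the average of \<open>h\<close> over the logarithmic part. The last
  hypothesis is conditional so that \<open>A = 0\<close>, the constant function, is covered
  too.\<close>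

lemma has_integral_compose_log_cutoff:
  assumes "0 \<le> A" "a + A \<le> b" "0 < A \<Longrightarrow> ((\<lambda>t. h (ln (A / (t - a)))) has_integral X * A) {a..a + A}"
  shows "((\<lambda>t. h (log_cutoff a A t)) has_integral X * A + (b - a - A) * h 0) {a..b}"
proof (rule has_integral_combine[of a "a + A"])
  show "((\<lambda>t. h (log_cutoff a A t)) has_integral X * A) {a..a + A}"
  proof (cases "A = 0")
    case False
    with assms have "((\<lambda>t. h (ln (A / (t - a)))) has_integral X * A) {a..a + A}" by simp
    then show ?thesis
    proof (rule has_integral_eq[rotated])
      fix t assume "t \<in> {a..a + A}"
      then have "\<not> t - a < A \<Longrightarrow> t - a = A" by auto
      then show "h (ln (A / (t - a))) = h (log_cutoff a A t)" using False by (auto simp: log_cutoff_def)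
    qed
  qed (use has_integral_refl(2)[of "\<lambda>t. h (log_cutoff a A t)" a] in simp)
  have "((\<lambda>t. h 0) has_integral (b - a - A) * h 0) {a + A..b}"
    using has_integral_const_real[of "h 0" "a + A" b] assms by (simp add: diff_diff_eq)
  then show "((\<lambda>t. h (log_cutoff a A t)) has_integral (b - a - A) * h 0) {a + A..b}"
    by (rule has_integral_eq[rotated]) (simp add: log_cutoff_def)
qed (use assms in auto)

section \<open>Integrals and oscillation of the extremal functions\<close>

context
  fixes a b A c \<kappa> :: real
  assumes ab: "a < b" and A: "0 \<le> A" "A \<le> b - a"
begin

lemma extremal_integrals:
  "((\<lambda>t. c + \<kappa> * log_cutoff a A t) has_integral (c + \<kappa>) * A + (b - a - A) * c) {a..b}"
  "((\<lambda>t. ((c + \<kappa> * log_cutoff a A t))\<^sup>2) has_integral (c\<^sup>2 + 2 * c * \<kappa> + 2 * \<kappa>\<^sup>2) * A + (b - a - A) * c\<^sup>2) {a..b}"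
  "\<kappa> < 1 \<Longrightarrow> ((\<lambda>t. exp ((c + \<kappa> * log_cutoff a A t))) has_integral (exp c / (1 - \<kappa>)) * A + (b - a - A) * exp c) {a..b}"
proof -
  have A': "a + A \<le> b" using A by simp
  have 1: "((\<lambda>t. c + \<kappa> * ln (A / (t - a))) has_integral (c + \<kappa>) * A) {a..a + A}" if "0 < A"
    using has_integral_add[OF has_integral_const_real[of c a "a + A"]
        has_integral_mult_right[OF has_integral_ln_singular(1)[OF that], of \<kappa>]] that
    by (simp add: algebra_simps)
  from has_integral_compose_log_cutoff[where h = "\<lambda>x. c + \<kappa> * x", OF A(1) A' this]
  show "((\<lambda>t. c + \<kappa> * log_cutoff a A t) has_integral (c + \<kappa>) * A + (b - a - A) * c) {a..b}" by simp
  have 2: "((\<lambda>t. (c + \<kappa> * ln (A / (t - a)))\<^sup>2) has_integral (c\<^sup>2 + 2 * c * \<kappa> + 2 * \<kappa>\<^sup>2) * A) {a..a + A}" if "0 < A"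
  proof -
    note L = has_integral_ln_singular(1,2)[OF that]
    have "((\<lambda>t. c\<^sup>2 + (2 * c * \<kappa> * ln (A / (t - a)) + \<kappa>\<^sup>2 * (ln (A / (t - a)))\<^sup>2)) has_integral
        measure lborel {a..a + A} *\<^sub>R c\<^sup>2 + (2 * c * \<kappa> * A + \<kappa>\<^sup>2 * (2 * A))) {a..a + A}"
      by (rule has_integral_add[OF has_integral_const_real has_integral_add[OF has_integral_mult_right[OF L(1)] has_integral_mult_right[OF L(2)]]])
    moreover have "(\<lambda>t. c\<^sup>2 + (2 * c * \<kappa> * ln (A / (t - a)) + \<kappa>\<^sup>2 * (ln (A / (t - a)))\<^sup>2)) = (\<lambda>t. (c + \<kappa> * ln (A / (t - a)))\<^sup>2)"
      by (simp add: power2_sum power_mult_distrib algebra_simps)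
    moreover have "measure lborel {a..a + A} *\<^sub>R c\<^sup>2 + (2 * c * \<kappa> * A + \<kappa>\<^sup>2 * (2 * A)) = (c\<^sup>2 + 2 * c * \<kappa> + 2 * \<kappa>\<^sup>2) * A"
      using that by (simp add: algebra_simps)
    ultimately show ?thesis by simp
  qed
  from has_integral_compose_log_cutoff[where h = "\<lambda>x. (c + \<kappa> * x)\<^sup>2", OF A(1) A' this]
  show "((\<lambda>t. ((c + \<kappa> * log_cutoff a A t))\<^sup>2) has_integral (c\<^sup>2 + 2 * c * \<kappa> + 2 * \<kappa>\<^sup>2) * A + (b - a - A) * c\<^sup>2) {a..b}" by simp
  assume "\<kappa> < 1"
  then have 3: "((\<lambda>t. exp (c + \<kappa> * ln (A / (t - a)))) has_integral (exp c / (1 - \<kappa>)) * A) {a..a + A}" if "0 < A"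
    using has_integral_mult_right[OF has_integral_ln_singular(3)[OF that], of \<kappa> "exp c"]
    by (simp add: exp_add)
  from has_integral_compose_log_cutoff[where h = "\<lambda>x. exp (c + \<kappa> * x)", OF A(1) A' this]
  show "((\<lambda>t. exp ((c + \<kappa> * log_cutoff a A t))) has_integral (exp c / (1 - \<kappa>)) * A + (b - a - A) * exp c) {a..b}" by simp
qed

lemma extremal_absolutely_integrable: "(\<lambda>t. c + \<kappa> * log_cutoff a A t) absolutely_integrable_on {a..b}"
proof -
  have "((\<lambda>t. log_cutoff a A t) has_integral 1 * A + (b - a - A) * 0) {a..b}"
  proof (rule has_integral_compose_log_cutoff[where h = "\<lambda>x. x"])
    show "((\<lambda>t. ln (A / (t - a))) has_integral 1 * A) {a..a + A}" if "0 < A"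
      using has_integral_ln_singular(1)[OF that] by simp
  qed (use A in simp_all)
  note L = has_integral_integrable[OF this]
  show ?thesis
  proof (rule absolutely_integrable_integrable_bound)
    show "(\<lambda>t. \<bar>c\<bar> + \<bar>\<kappa>\<bar> * log_cutoff a A t) integrable_on {a..b}"
      by (rule integrable_add[OF integrable_const_ivl integrable_on_mult_right[OF L]])
    show "norm ((c + \<kappa> * log_cutoff a A t)) \<le> \<bar>c\<bar> + \<bar>\<kappa>\<bar> * log_cutoff a A t" if "t \<in> {a..b}" for t
      using abs_triangle_ineq[of c "\<kappa> * log_cutoff a A t"] log_cutoff_nonneg[of a t A] that by (simp add: abs_mult)
    show "(\<lambda>t. c + \<kappa> * log_cutoff a A t) integrable_on {a..b}" by (rule has_integral_integrable[OF extremal_integrals(1)])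
  qed
qed

text \<open>Cutting off is 1-Lipschitz, so the variance bound for the pure logarithm survives. A
  negative \<kappa> is allowed, as only its square enters \<open>bmo_le\<close>.\<close>

lemma extremal_bmo_le: "bmo_le \<kappa> a b (\<lambda>t. c + \<kappa> * log_cutoff a A t)"
  unfolding bmo_le_def
proof (intro conjI allI impI extremal_absolutely_integrable)
  show sq: "(\<lambda>t. ((c + \<kappa> * log_cutoff a A t))\<^sup>2) integrable_on {a..b}" using extremal_integrals(2) by blast
  fix u v assume uv: "a \<le> u" "u < v" "v \<le> b"
  have i: "(\<lambda>t. c + \<kappa> * log_cutoff a A t) integrable_on {u..v}" "(\<lambda>t. ((c + \<kappa> * log_cutoff a A t))\<^sup>2) integrable_on {u..v}"
    using uv by (auto intro: integrable_on_subinterval[OF sq]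
        integrable_on_subinterval[OF has_integral_integrable[OF extremal_integrals(1)]])
  \<comment> \<open>The comparison constant \<open>ln (v - a) - 1\<close> for
    \<open>ln (t - a)\<close> becomes \<open>ln (A / (v - a)) + 1\<close> for
    \<open>ln (A / (t - a))\<close>; it is then cut off at 0 like the function itself.\<close>
  define d where "d = (if A = 0 then c else c + \<kappa> * max 0 (ln (A / (v - a)) + 1))"
  have bound: "((c + \<kappa> * log_cutoff a A t) - d)\<^sup>2 \<le> \<kappa>\<^sup>2 * (1 + ln ((t - a) / (v - a)))\<^sup>2" if "t \<in> {u..v}" "t \<noteq> a" for t
  proof (cases "A = 0")
    case True
    then have "log_cutoff a A t = 0" using that uv by (simp add: log_cutoff_def)
    with True show ?thesis by (simp add: d_def)
  next
    case False
    have pos: "0 < t - a" "0 < v - a" "0 < A" using that uv False A by auto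
    have "log_cutoff a A t = max 0 (ln (A / (t - a)))"
      using pos ln_ge_zero[of "A / (t - a)"] ln_le_zero_iff[of "A / (t - a)"]
      by (auto simp: log_cutoff_def)
    then have "(c + \<kappa> * log_cutoff a A t) - d = \<kappa> * (max 0 (ln (A / (t - a))) - max 0 (ln (A / (v - a)) + 1))"
      using False by (simp add: d_def algebra_simps)
    moreover have "\<bar>max 0 (ln (A / (t - a))) - max 0 (ln (A / (v - a)) + 1)\<bar> \<le> \<bar>1 + ln ((t - a) / (v - a))\<bar>"
    proof -
      have "ln (A / (t - a)) = ln A - ln (t - a)" "ln (A / (v - a)) = ln A - ln (v - a)"
        "ln ((t - a) / (v - a)) = ln (t - a) - ln (v - a)"
        using pos by (simp_all add: ln_div)
      then show ?thesis by linarith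
    qed
    ultimately have "\<bar>(c + \<kappa> * log_cutoff a A t) - d\<bar> \<le> \<bar>\<kappa> * (1 + ln ((t - a) / (v - a)))\<bar>"
      by (simp only: abs_mult mult_left_mono abs_ge_zero)
    then show ?thesis by (simp only: abs_le_square_iff power_mult_distrib)
  qed
  have "mean u v (\<lambda>t. ((c + \<kappa> * log_cutoff a A t))\<^sup>2) - (mean u v (\<lambda>t. c + \<kappa> * log_cutoff a A t))\<^sup>2 \<le> mean u v (\<lambda>t. ((c + \<kappa> * log_cutoff a A t) - d)\<^sup>2)"
    by (rule variance_le_mean_sq_dev[OF uv(2) i])
  also have "\<dots> \<le> \<kappa>\<^sup>2"
  proof -
    note di = integral_sq_dev(1)[OF uv(2) i, of d]
    \<comment> \<open>The point \<open>a\<close> is masked because \<open>bound\<close> is available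
      only for \<open>t \<noteq> a\<close>.\<close>
    have "integral {u..v} (\<lambda>t. ((c + \<kappa> * log_cutoff a A t) - d)\<^sup>2) = integral {u..v} (\<lambda>t. if t = a then 0 else ((c + \<kappa> * log_cutoff a A t) - d)\<^sup>2)"
      by (rule integral_spike[of "{a}"]) auto
    also have "\<dots> \<le> integral {u..v} (\<lambda>t. \<kappa>\<^sup>2 * (1 + ln ((t - a) / (v - a)))\<^sup>2)"
    proof (rule integral_le)
      show "(\<lambda>t. if t = a then 0 else ((c + \<kappa> * log_cutoff a A t) - d)\<^sup>2) integrable_on {u..v}"
        by (rule integrable_spike[OF di, of "{a}"]) auto
      show "(\<lambda>t. \<kappa>\<^sup>2 * (1 + ln ((t - a) / (v - a)))\<^sup>2) integrable_on {u..v}"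
        by (intro integrable_on_mult_right integral_ln_dev_le uv)
    qed (use bound in auto)
    also have "\<dots> \<le> \<kappa>\<^sup>2 * (v - u)"
      using integral_ln_dev_le(2)[OF uv(1,2)] by (simp add: mult_left_mono)
    finally show ?thesis using uv by (simp add: mean_def field_simps)
  qed
  finally show "mean u v (\<lambda>t. ((c + \<kappa> * log_cutoff a A t))\<^sup>2) - (mean u v (\<lambda>t. c + \<kappa> * log_cutoff a A t))\<^sup>2 \<le> \<kappa>\<^sup>2" .
qed

end

section \<open>The Bellman functions\<close>

lemma nn_avg_exp_bounds:
  assumes ab: "a < b" and I: "{a<..<b} \<subseteq> I" "I \<subseteq> {a..b}" and "0 \<le> \<epsilon>"
    and \<phi>: "\<phi> \<in> test_functions I \<epsilon> (x1, x2)"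
  shows "\<epsilon> < 1 \<Longrightarrow> nn_avg I (\<lambda>t. exp (\<phi> t)) \<le> ennreal (Bell 1 \<epsilon> x1 x2)"
    and "ennreal (Bell (-1) \<epsilon> x1 x2) \<le> nn_avg I (\<lambda>t. exp (\<phi> t))"
proof -
  from \<phi> have bmo: "bmo_le \<epsilon> a b \<phi>" and [simp]: "mean a b \<phi> = x1" "mean a b (\<lambda>t. (\<phi> t)\<^sup>2) = x2"
    by (auto simp: test_functions_iff[OF ab I \<open>0 \<le> \<epsilon>\<close>])
  have cancel: "ennreal ((b - a) * B) / ennreal (b - a) = ennreal B" for B
    using ab by (cases "0 \<le> B") (auto simp: divide_ennreal ennreal_neg mult_nonneg_nonpos)
  show "nn_avg I (\<lambda>t. exp (\<phi> t)) \<le> ennreal (Bell 1 \<epsilon> x1 x2)" if "\<epsilon> < 1"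
    using divide_right_mono_ennreal[OF nn_integral_exp_le_Bell[OF bmo ab \<open>0 \<le> \<epsilon>\<close> that], of "ennreal (b - a)"]
    by (simp add: nn_avg_eq[OF ab I] cancel)
  show "ennreal (Bell (-1) \<epsilon> x1 x2) \<le> nn_avg I (\<lambda>t. exp (\<phi> t))"
    using divide_right_mono_ennreal[OF Bell_le_nn_integral_exp[OF bmo ab \<open>0 \<le> \<epsilon>\<close>], of "ennreal (b - a)"]
    by (simp add: nn_avg_eq[OF ab I] cancel)
qed

text \<open>The fraction \<alpha> of the interval carrying the logarithm. The extremal has variance
  \<open>\<epsilon>\<^sup>2 * (1 - (1 - \<alpha>)\<^sup>2)\<close>; equating this with
  \<open>x2 - x1\<^sup>2\<close> and solving gives the formula.\<close>

definition cutoff_param :: "real \<Rightarrow> real \<Rightarrow> real \<Rightarrow> real" where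
  "cutoff_param \<epsilon> x1 x2 = 1 - sqrt (\<epsilon>\<^sup>2 + x1\<^sup>2 - x2) / \<epsilon>"

text \<open>For \<open>\<epsilon> = 0\<close> the parameter is \<open>1\<close>, because \<open>x / 0 = 0\<close>.\<close>

lemma cutoff_param:
  assumes "0 \<le> \<epsilon>" and \<Omega>: "(x1, x2) \<in> Omega \<epsilon>"
  shows "0 \<le> cutoff_param \<epsilon> x1 x2" "cutoff_param \<epsilon> x1 x2 \<le> 1"
    "\<epsilon> * (1 - cutoff_param \<epsilon> x1 x2) = sqrt (\<epsilon>\<^sup>2 + x1\<^sup>2 - x2)"
proof -
  define s where "s = sqrt (\<epsilon>\<^sup>2 + x1\<^sup>2 - x2)"
  have s: "0 \<le> s" "s \<le> \<epsilon>"
    using assms by (auto simp: s_def Omega_def intro!: real_le_lsqrt)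
  then show "0 \<le> cutoff_param \<epsilon> x1 x2" "cutoff_param \<epsilon> x1 x2 \<le> 1"
    "\<epsilon> * (1 - cutoff_param \<epsilon> x1 x2) = sqrt (\<epsilon>\<^sup>2 + x1\<^sup>2 - x2)"
    unfolding cutoff_param_def s_def[symmetric] by (cases "\<epsilon> = 0"; auto simp: field_simps)+
qed

text \<open>The cut-off logarithm has average \<alpha> over \<open>{a..b}\<close>, so the additive
  constant makes the mean \<open>x1\<close>.\<close>

definition extremal :: "real \<Rightarrow> real \<Rightarrow> real \<Rightarrow> real \<Rightarrow> real \<Rightarrow> real \<Rightarrow> real \<Rightarrow> real" where
  "extremal \<sigma> \<epsilon> x1 x2 a b = (let \<alpha> = cutoff_param \<epsilon> x1 x2 in
     (\<lambda>t. x1 - \<sigma> * \<epsilon> * \<alpha> + \<sigma> * \<epsilon> * log_cutoff a (\<alpha> * (b - a)) t))"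

text \<open>Averages are mixtures, with weights \<alpha> and \<open>1 - \<alpha>\<close>, of the
  logarithmic part and the constant. Divergence for \<epsilon> \<ge> 1 follows by comparison with
  the finite values at exponents below 1.\<close>

lemma extremal_test_function:
  assumes ab: "a < b" and I: "{a<..<b} \<subseteq> I" "I \<subseteq> {a..b}" and "0 \<le> \<epsilon>"
    and \<Omega>: "(x1, x2) \<in> Omega \<epsilon>" and \<sigma>: "\<sigma> = 1 \<or> \<sigma> = -1"
  shows "extremal \<sigma> \<epsilon> x1 x2 a b \<in> test_functions I \<epsilon> (x1, x2)"
    and "\<sigma> * \<epsilon> < 1 \<Longrightarrow> nn_avg I (\<lambda>t. exp (extremal \<sigma> \<epsilon> x1 x2 a b t)) = ennreal (Bell \<sigma> \<epsilon> x1 x2)"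
    and "\<sigma> = 1 \<Longrightarrow> 1 \<le> \<epsilon> \<Longrightarrow> x1\<^sup>2 < x2 \<Longrightarrow> nn_avg I (\<lambda>t. exp (extremal \<sigma> \<epsilon> x1 x2 a b t)) = \<infinity>"
proof -
  define \<alpha> where "\<alpha> = cutoff_param \<epsilon> x1 x2"
  define s where "s = sqrt (\<epsilon>\<^sup>2 + x1\<^sup>2 - x2)"
  define A where "A = \<alpha> * (b - a)"
  define \<kappa> where "\<kappa> = \<sigma> * \<epsilon>"
  define c where "c = x1 - \<kappa> * \<alpha>"
  have \<psi>: "extremal \<sigma> \<epsilon> x1 x2 a b = (\<lambda>t. c + \<kappa> * log_cutoff a A t)"
    by (simp add: extremal_def Let_def \<alpha>_def A_def \<kappa>_def c_def)
  note par = cutoff_param[OF \<open>0 \<le> \<epsilon>\<close> \<Omega>, folded \<alpha>_def s_def]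
  have s2: "s\<^sup>2 = \<epsilon>\<^sup>2 + x1\<^sup>2 - x2" using \<Omega> by (simp add: s_def Omega_def)
  have A: "0 \<le> A" "A \<le> b - a"
    using par ab mult_right_mono[of \<alpha> 1 "b - a"] by (auto simp: A_def)
  have \<kappa>2: "\<kappa>\<^sup>2 = \<epsilon>\<^sup>2" using \<sigma> by (auto simp: \<kappa>_def)
  note bmo = extremal_bmo_le[OF ab A, of \<kappa> c]
  note ints = extremal_integrals[OF ab A, where c = c and \<kappa> = \<kappa>]
  have mean_eq: "mean a b f = \<alpha> * X + (1 - \<alpha>) * Y" if "(f has_integral X * A + (b - a - A) * Y) {a..b}" for f X Y
  proof -
    have "X * A + (b - a - A) * Y = (b - a) * (\<alpha> * X + (1 - \<alpha>) * Y)" by (simp add: A_def algebra_simps)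
    with integral_unique[OF that] ab show ?thesis by (simp add: mean_def)
  qed
  have "bmo_le \<epsilon> a b (\<lambda>t. c + \<kappa> * log_cutoff a A t)"
    using bmo by (simp add: bmo_le_def \<kappa>2)
  moreover have "mean a b (\<lambda>t. c + \<kappa> * log_cutoff a A t) = x1"
    unfolding mean_eq[OF ints(1)] by (simp add: c_def algebra_simps)
  moreover have "mean a b (\<lambda>t. (c + \<kappa> * log_cutoff a A t)\<^sup>2) = x2"
  proof -
    have "\<alpha> * (c\<^sup>2 + 2 * c * \<kappa> + 2 * \<kappa>\<^sup>2) + (1 - \<alpha>) * c\<^sup>2 = (c + \<kappa> * \<alpha>)\<^sup>2 + \<kappa>\<^sup>2 - (\<kappa> * (1 - \<alpha>))\<^sup>2"
      by (simp add: power2_eq_square algebra_simps)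
    also have "(\<kappa> * (1 - \<alpha>))\<^sup>2 = s\<^sup>2" unfolding power_mult_distrib \<kappa>2 unfolding par(3)[symmetric] power_mult_distrib ..
    also have "(c + \<kappa> * \<alpha>)\<^sup>2 + \<kappa>\<^sup>2 - s\<^sup>2 = x2" unfolding s2 \<kappa>2 by (simp add: c_def)
    finally show ?thesis unfolding mean_eq[OF ints(2)] .
  qed
  ultimately show "extremal \<sigma> \<epsilon> x1 x2 a b \<in> test_functions I \<epsilon> (x1, x2)"
    by (simp add: \<psi> test_functions_iff[OF ab I \<open>0 \<le> \<epsilon>\<close>])
  show "nn_avg I (\<lambda>t. exp (extremal \<sigma> \<epsilon> x1 x2 a b t)) = ennreal (Bell \<sigma> \<epsilon> x1 x2)" if "\<sigma> * \<epsilon> < 1"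
  proof -
    have \<kappa>: "\<kappa> < 1" using that by (simp add: \<kappa>_def)
    have "(\<lambda>t. exp (c + \<kappa> * log_cutoff a A t)) absolutely_integrable_on {a..b}"
      by (rule nonnegative_absolutely_integrable_1[OF has_integral_integrable[OF ints(3)[OF \<kappa>]]]) simp
    then have "nn_avg I (\<lambda>t. exp (c + \<kappa> * log_cutoff a A t)) = ennreal (mean a b (\<lambda>t. exp (c + \<kappa> * log_cutoff a A t)))"
      by (rule nn_avg_eq_mean[OF ab I]) simp
    also have "mean a b (\<lambda>t. exp (c + \<kappa> * log_cutoff a A t)) = \<alpha> * (exp c / (1 - \<kappa>)) + (1 - \<alpha>) * exp c"
      by (rule mean_eq[OF ints(3)[OF \<kappa>]])
    also have "\<dots> = (1 - \<kappa> * (1 - \<alpha>)) / (1 - \<kappa>) * exp c" using \<kappa> by (simp add: field_simps)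
    also have "\<kappa> * (1 - \<alpha>) = \<sigma> * s" unfolding \<kappa>_def par(3)[symmetric] by simp
    finally have "nn_avg I (\<lambda>t. exp (c + \<kappa> * log_cutoff a A t)) = ennreal ((1 - \<sigma> * s) / (1 - \<kappa>) * exp c)" .
    moreover have "x1 + \<sigma> * s - \<sigma> * \<epsilon> = c"
      unfolding c_def \<kappa>_def par(3)[symmetric] by (simp add: algebra_simps)
    ultimately show ?thesis unfolding \<psi> Bell_def s_def[symmetric] by (simp add: \<kappa>_def)
  qed
  show "nn_avg I (\<lambda>t. exp (extremal \<sigma> \<epsilon> x1 x2 a b t)) = \<infinity>" if \<open>\<sigma> = 1\<close> "1 \<le> \<epsilon>" "x1\<^sup>2 < x2"
  proof -
    have "1 \<le> \<kappa>" using that by (simp add: \<kappa>_def)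
    have "0 < \<alpha>"
    proof -
      have "s < \<epsilon>"
      proof (rule power2_less_imp_less)
        show "s\<^sup>2 < \<epsilon>\<^sup>2" using that by (simp add: s2)
      qed (use that in simp)
      with par(3) have "\<epsilon> * (1 - \<alpha>) < \<epsilon> * 1" by simp
      with that show ?thesis by (simp only: mult_less_cancel_left) auto
    qed
    then have "0 < A" using ab by (simp add: A_def)
    let ?X = "nn_avg I (\<lambda>t. exp (c + \<kappa> * log_cutoff a A t))"
    have big: "ennreal (real n * (\<alpha> * exp c)) \<le> ?X" if "0 < n" for n :: nat
    proof -
      \<comment> \<open>Chosen so that \<open>1 / (1 - k) = n\<close>: the logarithmic part alone
        then contributes \<open>n * (\<alpha> * exp c)\<close>.\<close>
      define k where "k = 1 - 1 / real n"
      have k: "k < 1" "0 \<le> k" using that by (auto simp: k_def)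
      note kints = extremal_integrals[OF ab A, where c = c and \<kappa> = k]
      have "(\<lambda>t. exp (c + k * log_cutoff a A t)) absolutely_integrable_on {a..b}"
        by (rule nonnegative_absolutely_integrable_1[OF has_integral_integrable[OF kints(3)[OF k(1)]]]) simp
      then have eq: "nn_avg I (\<lambda>t. exp (c + k * log_cutoff a A t)) = ennreal (\<alpha> * (exp c / (1 - k)) + (1 - \<alpha>) * exp c)"
        using mean_eq[OF kints(3)[OF k(1)]] by (simp add: nn_avg_eq_mean[OF ab I])
      have "real n * (\<alpha> * exp c) \<le> \<alpha> * (exp c / (1 - k)) + (1 - \<alpha>) * exp c"
        using par(2) by (simp add: k_def mult_ac)
      then have "ennreal (real n * (\<alpha> * exp c)) \<le> nn_avg I (\<lambda>t. exp (c + k * log_cutoff a A t))"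
        unfolding eq by (rule ennreal_leI)
      also have "\<dots> \<le> ?X"
        unfolding nn_avg_eq[OF ab I]
      proof (intro divide_right_mono_ennreal nn_integral_mono)
        fix t
        have "k * log_cutoff a A t \<le> \<kappa> * log_cutoff a A t" if "t \<in> {a..b}"
          using log_cutoff_nonneg[of a t A] that k \<open>1 \<le> \<kappa>\<close> by (intro mult_right_mono) auto
        then show "ennreal (exp (c + k * log_cutoff a A t)) * indicator {a..b} t
            \<le> ennreal (exp (c + \<kappa> * log_cutoff a A t)) * indicator {a..b} t"
          by (auto simp: indicator_def intro: ennreal_leI)
      qed
      finally show ?thesis .
    qed
    have "?X = \<infinity>"
    proof (rule ccontr)
      assume "?X \<noteq> \<infinity>"
      then obtain r where r: "0 \<le> r" "?X = ennreal r" by (cases ?X) auto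
      have pos: "0 < \<alpha> * exp c" using \<open>0 < \<alpha>\<close> by simp
      obtain n :: nat where n: "r < real n * (\<alpha> * exp c)"
        using reals_Archimedean3[OF pos] by blast
      then have "0 < n" using r(1) by (cases n) auto
      from big[OF this] have "real n * (\<alpha> * exp c) \<le> r" using r by simp
      with n show False by simp
    qed
    then show ?thesis by (simp add: \<psi>)
  qed
qed

text \<open>At \<open>x2 = x1\<^sup>2\<close> the integral of \<open>(\<phi> t - x1)\<^sup>2\<close>
  over the whole interval vanishes, hence over every subinterval. The value for any \<epsilon>,
  including \<epsilon> \<ge> 1, can thus be read off the explicit formula at radius 0.\<close>

lemma test_functions_lower_boundary:
  assumes ab: "a < b" and I: "{a<..<b} \<subseteq> I" "I \<subseteq> {a..b}" and "0 \<le> \<epsilon>"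
  shows "test_functions I \<epsilon> (x1, x1\<^sup>2) = test_functions I 0 (x1, x1\<^sup>2)"
proof (intro set_eqI)
  fix \<phi>
  have "bmo_le 0 a b \<phi>" if bmo: "bmo_le \<epsilon> a b \<phi>" and eq: "mean a b \<phi> = x1" "mean a b (\<lambda>t. (\<phi> t)\<^sup>2) = x1\<^sup>2"
    unfolding bmo_le_def
  proof (intro conjI allI impI)
    fix u v assume uv: "a \<le> u" "u < v" "v \<le> b"
    note int = bmo_leD[OF bmo order.refl order.refl] and int' = bmo_leD[OF bmo uv(1,3)]
    have "integral {a..b} (\<lambda>t. (\<phi> t - x1)\<^sup>2) = 0"
    proof -
      have "x1\<^sup>2 - 2 * x1 * x1 + x1\<^sup>2 = 0" by (simp add: power2_eq_square)
      then show ?thesis unfolding integral_sq_dev(2)[OF ab int(1,2)] eq by simp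
    qed
    moreover have "integral {u..v} (\<lambda>t. (\<phi> t - x1)\<^sup>2) \<le> integral {a..b} (\<lambda>t. (\<phi> t - x1)\<^sup>2)"
      using uv by (intro integral_subset_le integral_sq_dev(1)[OF ab int(1,2)] integral_sq_dev(1)[OF uv(2) int'(1,2)]) auto
    ultimately have "mean u v (\<lambda>t. (\<phi> t - x1)\<^sup>2) \<le> 0"
      using uv by (simp add: mean_def divide_nonpos_pos)
    with variance_le_mean_sq_dev[OF uv(2) int'(1,2), of x1]
    show "mean u v (\<lambda>t. (\<phi> t)\<^sup>2) - (mean u v \<phi>)\<^sup>2 \<le> 0\<^sup>2" by simp
  qed (use bmo in \<open>auto simp: bmo_le_def\<close>)
  moreover have "bmo_le \<epsilon> a b \<phi>" if "bmo_le 0 a b \<phi>"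
    unfolding bmo_le_def
  proof (intro conjI allI impI)
    fix u v assume uv: "a \<le> u" "u < v" "v \<le> b"
    have "(0::real)\<^sup>2 \<le> \<epsilon>\<^sup>2" by simp
    then show "mean u v (\<lambda>t. (\<phi> t)\<^sup>2) - (mean u v \<phi>)\<^sup>2 \<le> \<epsilon>\<^sup>2"
      by (rule order.trans[OF bmo_leD(4)[OF that uv(1,3,2)]])
  qed (use that in \<open>auto simp: bmo_le_def\<close>)
  ultimately show "\<phi> \<in> test_functions I \<epsilon> (x1, x1\<^sup>2) \<longleftrightarrow> \<phi> \<in> test_functions I 0 (x1, x1\<^sup>2)"
    unfolding test_functions_iff[OF ab I \<open>0 \<le> \<epsilon>\<close>] test_functions_iff[OF ab I order.refl] by blast
qed

theorem mainTheorem3: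
  fixes \<epsilon> x1 x2 :: real and I :: "real set"
  assumes "\<epsilon> \<ge> 0"
    and "(x1, x2) \<in> Omega \<epsilon>"
    and "bdd_interval I"
  shows "(\<epsilon> < 1 \<longrightarrow> Bellman_sup I \<epsilon> (x1, x2) = ennreal (B_plus \<epsilon> (x1, x2)))
    \<and> (\<epsilon> \<ge> 1 \<longrightarrow>
         (x2 = x1\<^sup>2 \<longrightarrow> Bellman_sup I \<epsilon> (x1, x2) = ennreal (exp x1)) \<and>
         (x2 > x1\<^sup>2 \<longrightarrow> Bellman_sup I \<epsilon> (x1, x2) = \<infinity>))
    \<and> Bellman_inf I \<epsilon> (x1, x2) = ennreal (B_minus \<epsilon> (x1, x2))"
proof -
  obtain a b where ab: "a < b" and I: "{a<..<b} \<subseteq> I" "I \<subseteq> {a..b}"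
    using bdd_interval_bounds[OF assms(3)] by blast
  note bounds = nn_avg_exp_bounds[OF ab I]
  note ext = extremal_test_function[OF ab I]
  \<comment> \<open>Stated for an arbitrary radius, since \<open>point\<close> applies it at radius
    0 as well.\<close>
  have sup: "Bellman_sup I \<delta> (y1, y2) = ennreal (B_plus \<delta> (y1, y2))"
    if "0 \<le> \<delta>" "\<delta> < 1" "(y1, y2) \<in> Omega \<delta>" for \<delta> y1 y2
  proof -
    note ext = ext[OF that(1,3), of 1]
    have "Bellman_sup I \<delta> (y1, y2) = ennreal (Bell 1 \<delta> y1 y2)"
      unfolding Bellman_sup_def
    proof (intro antisym SUP_least bounds(1)[OF that(1) _ that(2)])
      have "nn_avg I (\<lambda>t. exp (extremal 1 \<delta> y1 y2 a b t)) = ennreal (Bell 1 \<delta> y1 y2)"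
        using ext(2) that by simp
      with SUP_upper[OF ext(1), of "\<lambda>\<phi>. nn_avg I (\<lambda>t. exp (\<phi> t))"]
      show "ennreal (Bell 1 \<delta> y1 y2) \<le> (SUP \<phi>\<in>test_functions I \<delta> (y1, y2). nn_avg I (\<lambda>t. exp (\<phi> t)))"
        by simp
    qed
    then show ?thesis by (simp add: B_plus_def Bell_def)
  qed
  have "Bellman_inf I \<epsilon> (x1, x2) = ennreal (Bell (-1) \<epsilon> x1 x2)"
    unfolding Bellman_inf_def
  proof (intro antisym INF_greatest bounds(2)[OF assms(1)])
    note ext = ext[OF assms(1,2), of "-1"]
    have "nn_avg I (\<lambda>t. exp (extremal (-1) \<epsilon> x1 x2 a b t)) = ennreal (Bell (-1) \<epsilon> x1 x2)"
      using ext(2) assms(1) by simp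
    with INF_lower[OF ext(1), of "\<lambda>\<phi>. nn_avg I (\<lambda>t. exp (\<phi> t))"]
    show "(INF \<phi>\<in>test_functions I \<epsilon> (x1, x2). nn_avg I (\<lambda>t. exp (\<phi> t))) \<le> ennreal (Bell (-1) \<epsilon> x1 x2)"
      by simp
  qed
  then have inf: "Bellman_inf I \<epsilon> (x1, x2) = ennreal (B_minus \<epsilon> (x1, x2))"
    by (simp add: B_minus_def Bell_def)
  have point: "Bellman_sup I \<epsilon> (x1, x2) = ennreal (exp x1)" if "x2 = x1\<^sup>2"
  proof -
    have "Bellman_sup I \<epsilon> (x1, x2) = Bellman_sup I 0 (x1, x1\<^sup>2)"
      unfolding Bellman_sup_def that test_functions_lower_boundary[OF ab I assms(1)] ..
    also have "\<dots> = ennreal (B_plus 0 (x1, x1\<^sup>2))"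
      by (rule sup) (auto simp: Omega_def)
    also have "\<dots> = ennreal (exp x1)" by (simp add: B_plus_def)
    finally show ?thesis .
  qed
  have infinite: "Bellman_sup I \<epsilon> (x1, x2) = \<infinity>" if "1 \<le> \<epsilon>" "x1\<^sup>2 < x2"
  proof -
    note ext = ext[OF assms(1,2), of 1]
    have "nn_avg I (\<lambda>t. exp (extremal 1 \<epsilon> x1 x2 a b t)) = \<infinity>" using ext(3) that by simp
    with SUP_upper[OF ext(1), of "\<lambda>\<phi>. nn_avg I (\<lambda>t. exp (\<phi> t))"]
    show ?thesis unfolding Bellman_sup_def by (simp add: top_unique)
  qed
  show ?thesis using sup[OF assms(1) _ assms(2)] point infinite inf by blast
qed

end
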